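(* Let $a$ and $c$ be positive integers with $a<c$ such that $c$ divides $a^2$, and let $b=c-a^2/c$. Let $\alpha,\beta,\gamma$ be the angles of the triangle with sides $(a,b,c)$ opposite $a,b,c$ respectively (so that $3\alpha+2\beta=\pi$ and $b$ is an integer). Then some triangle $ABC$ with angles $(2\alpha,\alpha,2\beta)$ can be $N$-tiled by the tile $(a,b,c)$, where the number $N$ of tiles in the tiling is given by $$N=M^2\,\frac{(2-s^2)(3-s^2)}{(1-s)^2(2+s)^2},$$ with $s=a/c$, $\ell$ the least common multiple of $a$ and $c$, and $$M=\ell(2-s^2-s),$$ which is an integer.
   Context: An $N$-tiling of a triangle $ABC$ by a triangle $T$ (the tile) is a way of writing $ABC$ as a union of $N$ triangles congruent to $T$ (reflections allowed) overlapping only at their boundaries; tiles need not meet edge-to-edge. *)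

theory Defs
  imports "HOL-Analysis.Analysis"
begin

text \<open>The unoriented angle \<open>PQR\<close> at the vertex \<open>Q\<close>, a value in \<open>[0, \<pi>]\<close>
  (meaningful when \<open>P\<close> and \<open>R\<close> differ from \<open>Q\<close>).\<close>

definition angle_at :: "real ^ 2 \<Rightarrow> real ^ 2 \<Rightarrow> real ^ 2 \<Rightarrow> real" where
  "angle_at P Q R = arccos (((P - Q) \<bullet> (R - Q)) / (norm (P - Q) * norm (R - Q)))"

text \<open>A distance-preserving map of the plane into itself is automatically onto, and it may
  reverse orientation; so mirror images count as congruent.\<close>

definition congruent_sets :: "(real ^ 2) set \<Rightarrow> (real ^ 2) set \<Rightarrow> bool" where
  "congruent_sets S T \<longleftrightarrow>
     (\<exists>f :: real ^ 2 \<Rightarrow> real ^ 2. (\<forall>x y. dist (f x) (f y) = dist x y) \<and> f ` S = T)"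

definition tiled_by :: "nat \<Rightarrow> (real ^ 2) set \<Rightarrow> (real ^ 2) set \<Rightarrow> bool" where
  "tiled_by N K T \<longleftrightarrow>
     (\<exists>\<T>. finite \<T> \<and> card \<T> = N \<and> (\<forall>S\<in>\<T>. congruent_sets T S) \<and> \<Union>\<T> = K \<and>
          pairwise (\<lambda>S S'. S \<inter> S' \<subseteq> frontier S \<inter> frontier S') \<T>)"

text \<open>A triangle with sides \<open>a\<close>, \<open>b = c - a\<^sup>2 / c\<close>, \<open>c\<close> exists whenever \<open>0 < a < c\<close>, so
  hypotheses prescribing these side lengths can be met.\<close>

lemma tile_exists:
  fixes a b c :: real
  assumes "0 < a" "a < c" "b = c - a\<^sup>2 / c"
  shows "\<exists>P Q R :: real ^ 2. \<not> collinear {P, Q, R} \<and> dist Q R = a \<and> dist P R = b \<and> dist P Q = c"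
proof -
  define k where "k = 1 - a\<^sup>2 / (2 * c\<^sup>2)"
  define h where "h = sqrt (1 - k\<^sup>2)"
  have c: "c > 0" using assms by simp
  have ac: "a\<^sup>2 < c\<^sup>2" using assms by (simp add: power_strict_mono)
  have "a\<^sup>2 < 2 * c\<^sup>2" using ac zero_le_power2[of c] by linarith
  then have k: "0 < k" "k < 1" using assms(1) c by (auto simp: k_def divide_simps)
  have k1: "k\<^sup>2 < 1" using k by (simp add: power_less_one_iff)
  then have h: "h > 0" "h\<^sup>2 = 1 - k\<^sup>2" by (simp_all add: h_def)
  have "c * b = c\<^sup>2 - a\<^sup>2" using c assms(3) by (simp add: field_simps power2_eq_square)
  then have a2: "a\<^sup>2 = c\<^sup>2 - c * b" by simp
  then have "c * b > 0" using ac by simp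
  then have b: "b > 0" using c by (simp add: zero_less_mult_iff)
  define P Q R :: "real ^ 2" where "P = 0" and "Q = vector [c, 0]" and "R = vector [b * k, b * h]"
  note d = dist_vec_def L2_set_def UNIV_2 dist_real_def P_def Q_def R_def
  have 1: "dist P Q = c" using c by (simp add: d)
  have "(b * k)\<^sup>2 + (b * h)\<^sup>2 = b\<^sup>2" by (simp add: power_mult_distrib h(2) algebra_simps)
  then have 2: "dist P R = b" using b by (simp add: d)
  have ck: "2 * c\<^sup>2 * k = 2 * c\<^sup>2 - a\<^sup>2" using c by (simp add: k_def field_simps)
  have "c * (2 * c * k) = c * (c + b)"
    using ck a2 by (simp add: power2_eq_square algebra_simps)
  then have "2 * c * k = c + b" using c by simp
  then have "2 * c * (b * k) = b * (c + b)" by (simp add: algebra_simps)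
  moreover have "(c - b * k)\<^sup>2 + (b * h)\<^sup>2 = c\<^sup>2 - 2 * c * (b * k) + b\<^sup>2"
    unfolding power_mult_distrib h(2) by (simp add: power2_eq_square algebra_simps)
  ultimately have "(c - b * k)\<^sup>2 + (b * h)\<^sup>2 = a\<^sup>2"
    using a2 by (simp add: power2_eq_square algebra_simps)
  then have 3: "dist Q R = a" using assms(1) by (simp add: d)
  have "\<not> collinear {P, Q, R}"
  proof
    assume "collinear {P, Q, R}"
    then obtain t where "Q = 0 \<or> R = 0 \<or> R = t *\<^sub>R Q"
      unfolding P_def collinear_lemma by blast
    moreover have "Q $ 1 \<noteq> 0" "Q $ 2 = 0" "R $ 2 \<noteq> 0"
      using b c h by (auto simp: Q_def R_def)
    ultimately show False by auto
  qed
  with 1 2 3 show ?thesis by blast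
qed

end

theory Submission
  imports Defs
begin

text \<open>
  Let \<open>l\<close> be the least common multiple of \<open>a\<close> and \<open>c\<close>, and scale \<open>ABC\<close> so that \<open>AC = l c\<close>; then
  \<open>BC = l (b + c)\<close>. Choose \<open>K\<close> on \<open>AB\<close> with \<open>AK = l b\<close>, \<open>F\<close> on \<open>BC\<close> with \<open>CF = l a\<close>, and draw
  \<open>FG\<close> parallel to \<open>KC\<close> with \<open>G\<close> on \<open>AB\<close> and \<open>FJ\<close> parallel to \<open>AB\<close> with \<open>J\<close> on \<open>CK\<close>. The
  triangles \<open>FGB\<close> and \<open>FCJ\<close> are then similar to the tile with ratios \<open>M\<close> and \<open>l s\<close>, and
  \<open>KGFJ\<close> is a parallelogram. The remaining triangle \<open>ACK\<close>, with angles \<open>2\<alpha>\<close>, \<open>\<beta>\<close>,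
  \<open>\<alpha> + \<beta>\<close>, is cut in four: with \<open>D\<close> on \<open>AC\<close>, \<open>I\<close> on \<open>CK\<close> and \<open>H\<close> on the bisector
  of the angle at \<open>A\<close> such that \<open>AD = l c s\<^sup>2\<close>, \<open>AH = l b (1 - s\<^sup>2)\<close> and \<open>ADIH\<close> is a
  parallelogram, the triangles \<open>DCI\<close>, \<open>AHK\<close> and \<open>HIK\<close> are similar to the tile with ratios
  \<open>l (1 - s\<^sup>2)\<close>, \<open>l (1 - s\<^sup>2)\<close> and \<open>l s\<close>. Since \<open>c\<close> divides \<open>l\<close> and \<open>a\<^sup>2\<close>, all ratios are
  integers, and so are the sides of the two parallelograms measured in sides of the tile. Hence
  each of the seven pieces has the obvious lattice tiling.
\<close>

section \<open>Dissections\<close>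

definition nonoverlapping :: "(real ^ 2) set \<Rightarrow> (real ^ 2) set \<Rightarrow> bool" where
  "nonoverlapping K L \<longleftrightarrow> interior K \<inter> interior L = {}"

text \<open>Working form of \<open>tiled_by\<close>: disjointness of interiors passes to unions of
  closed sets. The frontier condition is recovered once, in
  \<open>dissects_imp_tiled_by\<close>.\<close>

definition dissects :: "(real ^ 2) set \<Rightarrow> nat \<Rightarrow> (real ^ 2) set \<Rightarrow> bool" where
  "dissects T N K \<longleftrightarrow>
     (\<exists>\<T>. finite \<T> \<and> card \<T> = N \<and> (\<forall>S\<in>\<T>. congruent_sets T S) \<and> \<Union>\<T> = K \<and>
          pairwise nonoverlapping \<T>)"

lemma nonoverlapping_sym: "nonoverlapping K L \<Longrightarrow> nonoverlapping L K"
  by (auto simp: nonoverlapping_def)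

lemma nonoverlapping_mono:
  "nonoverlapping K L \<Longrightarrow> K' \<subseteq> K \<Longrightarrow> L' \<subseteq> L \<Longrightarrow> nonoverlapping K' L'"
  unfolding nonoverlapping_def using interior_mono by blast

text \<open>Let \<open>U\<close> be open inside both \<open>K1 \<union> K2\<close> and
  \<open>L\<close>. Closedness of \<open>K1\<close> makes \<open>U - K1\<close> open; it lies in
  \<open>K2\<close> and \<open>L\<close>, so it is empty. Hence \<open>U\<close> lies in
  \<open>K1\<close> and is itself empty.\<close>

lemma nonoverlapping_Un:
  assumes "closed K1" "nonoverlapping K1 L" "nonoverlapping K2 L"
  shows "nonoverlapping (K1 \<union> K2) L"
proof -
  define U where "U = interior (K1 \<union> K2) \<inter> interior L"
  have "open U" by (simp add: U_def open_Int)
  have U: "U \<subseteq> K1 \<union> K2" "U \<subseteq> L" using interior_subset by (auto simp: U_def)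
  have "U - K1 \<subseteq> interior K2" "U - K1 \<subseteq> interior L"
    using U \<open>open U\<close> assms(1) by (intro interior_maximal open_Diff; blast)+
  then have "U \<subseteq> K1" using assms(3) by (auto simp: nonoverlapping_def)
  then have "U \<subseteq> interior K1" "U \<subseteq> interior L"
    using U \<open>open U\<close> by (simp_all add: interior_maximal)
  then show ?thesis using assms(2) by (auto simp: nonoverlapping_def U_def)
qed

text \<open>A line has empty interior. Every separation below rests on this criterion.\<close>

lemma nonoverlapping_line:
  assumes "w \<noteq> 0" "\<And>z. z \<in> K \<Longrightarrow> z \<in> L \<Longrightarrow> w \<bullet> z = k"
  shows "nonoverlapping K L"
proof -
  have "K \<inter> L \<subseteq> {z. w \<bullet> z = k}" using assms(2) by auto
  then have "interior (K \<inter> L) \<subseteq> interior {z. w \<bullet> z = k}" by (rule interior_mono)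
  then show ?thesis using assms(1) by (simp add: nonoverlapping_def interior_hyperplane)
qed

section \<open>Isometries and congruent sets\<close>

lemma isometry_continuous:
  fixes f :: "real ^ 2 \<Rightarrow> real ^ 2"
  assumes "\<And>x y. dist (f x) (f y) = dist x y"
  shows "continuous_on A f"
  unfolding continuous_on_iff using assms by auto

lemma isometry_inj:
  fixes f :: "real ^ 2 \<Rightarrow> real ^ 2"
  assumes "\<And>x y. dist (f x) (f y) = dist x y"
  shows "inj_on f A"
  by (rule inj_onI) (metis assms dist_eq_0_iff)

lemma congruent_sets_trans:
  assumes "congruent_sets S T" "congruent_sets T U" shows "congruent_sets S U"
proof -
  from assms obtain f g where fg: "\<forall>x y. dist (f x) (f y) = dist x y" "f ` S = T"
    "\<forall>x y. dist (g x) (g y) = dist x y" "g ` T = U"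
    unfolding congruent_sets_def by blast
  then have "\<forall>x y. dist ((g \<circ> f) x) ((g \<circ> f) y) = dist x y" "(g \<circ> f) ` S = U"
    by (auto simp: image_comp[symmetric])
  then show ?thesis unfolding congruent_sets_def by blast
qed

lemma congruent_sets_compact: "congruent_sets S T \<Longrightarrow> compact S \<Longrightarrow> compact T"
  unfolding congruent_sets_def by (auto intro!: compact_continuous_image isometry_continuous)

text \<open>An isometry is continuous and injective, so by invariance of domain it maps the interior
  to an open set. Thus every copy of the tile is contained in the closure of its own
  interior.\<close>

lemma congruent_sets_interior:
  assumes "congruent_sets S T" "S \<subseteq> closure (interior S)"
  shows "T \<subseteq> closure (interior T)"
proof -
  from assms(1) obtain f where f: "\<And>x y. dist (f x) (f y) = dist x y" "f ` S = T"
    unfolding congruent_sets_def by blast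
  have "open (f ` interior S)"
    using invariance_of_domain[OF isometry_continuous _ isometry_inj] f(1) by blast
  then have "f ` interior S \<subseteq> interior T"
    using f(2) interior_subset by (intro interior_maximal) auto
  then have "closure (f ` interior S) \<subseteq> closure (interior T)" by (rule closure_mono)
  moreover have "f ` closure (interior S) \<subseteq> closure (f ` interior S)"
    by (intro image_closure_subset isometry_continuous f(1) closed_closure closure_subset)
  ultimately show ?thesis using f(2) assms(2) by blast
qed

section \<open>Joining dissections and returning to tilings\<close>

lemma dissects_single: "congruent_sets T S \<Longrightarrow> dissects T 1 S"
  unfolding dissects_def by (rule exI[of _ "{S}"]) auto

text \<open>The counts add because no tile occurs in both families: it would not overlap itself, so
  its interior would be empty, and by the assumption on \<open>T\<close> so would the tile.\<close>

lemma dissects_Un: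
  assumes T: "T \<noteq> {}" "T \<subseteq> closure (interior T)"
    and K: "dissects T m K" and L: "dissects T n L" and KL: "nonoverlapping K L"
  shows "dissects T (m + n) (K \<union> L)"
proof -
  from K obtain F where F: "finite F" "card F = m" "\<forall>S\<in>F. congruent_sets T S" "\<Union>F = K"
    "pairwise nonoverlapping F" unfolding dissects_def by blast
  from L obtain G where G: "finite G" "card G = n" "\<forall>S\<in>G. congruent_sets T S" "\<Union>G = L"
    "pairwise nonoverlapping G" unfolding dissects_def by blast
  have FG: "nonoverlapping S S'" if "S \<in> F" "S' \<in> G" for S S'
    using that F(4) G(4) by (intro nonoverlapping_mono[OF KL]) auto
  have "F \<inter> G = {}"
  proof (rule ccontr)
    assume "F \<inter> G \<noteq> {}"
    then obtain S where S: "S \<in> F" "S \<in> G" by auto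
    then have "interior S = {}" using FG[of S S] by (simp add: nonoverlapping_def)
    then have "S = {}" using congruent_sets_interior[OF _ T(2)] F(3) S(1) by force
    moreover have "S \<noteq> {}" using F(3) S(1) T(1) by (auto simp: congruent_sets_def)
    ultimately show False by simp
  qed
  then have "card (F \<union> G) = m + n" using F G by (simp add: card_Un_disjoint)
  moreover have "pairwise nonoverlapping (F \<union> G)"
    using F(5) G(5) FG nonoverlapping_sym[OF FG] unfolding pairwise_def by (metis Un_iff)
  ultimately show ?thesis
    unfolding dissects_def using F G by (intro exI[of _ "F \<union> G"]) auto
qed

text \<open>A point of \<open>S\<close> interior to \<open>S'\<close> would be a limit of interior
  points of \<open>S\<close>, so the interiors would meet. Common points of two tiles are therefore
  interior to neither, and the tiles are closed.\<close>

lemma dissects_imp_tiled_by: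
  assumes T: "compact T" "T \<subseteq> closure (interior T)" and K: "dissects T N K"
  shows "tiled_by N K T"
proof -
  have *: "S \<inter> S' \<subseteq> frontier S \<inter> frontier S'"
    if "congruent_sets T S" "congruent_sets T S'" "nonoverlapping S S'" for S S'
  proof -
    have "closed S" "closed S'"
      using that T(1) congruent_sets_compact compact_imp_closed by blast+
    moreover have "closure (interior S) \<inter> interior S' = {}" "closure (interior S') \<inter> interior S = {}"
      using that(3) open_Int_closure_eq_empty[of "interior S'" "interior S"]
        open_Int_closure_eq_empty[of "interior S" "interior S'"]
      by (auto simp: nonoverlapping_def)
    moreover have "S \<subseteq> closure (interior S)" "S' \<subseteq> closure (interior S')"
      using that T(2) congruent_sets_interior by blast+
    ultimately have "S \<inter> interior S' = {}" "S' \<inter> interior S = {}" by blast+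
    then show ?thesis
      using \<open>closed S\<close> \<open>closed S'\<close> by (auto simp: frontier_def closure_closed)
  qed
  from K obtain F where F: "finite F" "card F = N" "\<forall>S\<in>F. congruent_sets T S" "\<Union>F = K"
    "pairwise nonoverlapping F" unfolding dissects_def by blast
  have "pairwise (\<lambda>S S'. S \<inter> S' \<subseteq> frontier S \<inter> frontier S') F"
    unfolding pairwise_def
  proof (intro ballI impI)
    fix S S' assume "S \<in> F" "S' \<in> F" "S \<noteq> S'"
    then show "S \<inter> S' \<subseteq> frontier S \<inter> frontier S'"
      using F(3,5) by (intro *) (auto simp: pairwise_def)
  qed
  then show ?thesis unfolding tiled_by_def using F by (intro exI[of _ F]) simp
qed

section \<open>Lattice tilings of triangles and parallelograms\<close>

definition wedge :: "real ^ 2 \<Rightarrow> real ^ 2 \<Rightarrow> real" where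
  "wedge u v = u $ 1 * v $ 2 - u $ 2 * v $ 1"

lemma inner_2: "(u :: real ^ 2) \<bullet> v = u $ 1 * v $ 1 + u $ 2 * v $ 2"
  by (simp add: inner_vec_def UNIV_2)

lemma vec_eq_2: "(u :: real ^ 2) = v \<longleftrightarrow> u $ 1 = v $ 1 \<and> u $ 2 = v $ 2"
  by (simp add: vec_eq_iff forall_2)

text \<open>Lagrange's identity: side lengths determine the determinant up to sign.\<close>

lemma wedge_square: "(wedge u v)\<^sup>2 = (norm u)\<^sup>2 * (norm v)\<^sup>2 - (u \<bullet> v)\<^sup>2"
  unfolding power2_norm_eq_inner by (simp add: wedge_def inner_2 power2_eq_square algebra_simps)

lemma Cramer_2:
  assumes "wedge u v \<noteq> 0"
  shows "d = (wedge d v / wedge u v) *\<^sub>R u + (wedge u d / wedge u v) *\<^sub>R v"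
proof -
  have "wedge u v *\<^sub>R d = wedge d v *\<^sub>R u + wedge u d *\<^sub>R v"
    by (simp add: vec_eq_2 wedge_def algebra_simps)
  then have "(1 / wedge u v) *\<^sub>R (wedge u v *\<^sub>R d) =
      (1 / wedge u v) *\<^sub>R (wedge d v *\<^sub>R u + wedge u d *\<^sub>R v)" by simp
  then show ?thesis using assms by (simp add: algebra_simps)
qed

lemma collinear_wedge:
  assumes "collinear {A, B, C}" shows "wedge (B - A) (C - A) = 0"
proof -
  have "collinear {0, B - A, C - A}"
    using assms collinear_3[of B A C] by (simp add: insert_commute)
  then consider "B - A = 0" | "C - A = 0" | c where "C - A = c *\<^sub>R (B - A)"
    unfolding collinear_lemma by blast
  then show ?thesis
  proof cases
    case 3
    show ?thesis unfolding 3 by (simp add: wedge_def)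
  qed (simp_all only: wedge_def zero_index mult_zero_left mult_zero_right diff_self)
qed

section \<open>Regularity and congruence of triangles\<close>

lemma triangle_regular:
  fixes A B C :: "real ^ 2"
  assumes "\<not> collinear {A, B, C}"
  shows "convex hull {A, B, C} \<subseteq> closure (interior (convex hull {A, B, C}))"
proof -
  have "A \<noteq> B" "A \<noteq> C" "B \<noteq> C" "\<not> affine_dependent {A, B, C}"
    using assms collinear_3_eq_affine_dependent by blast+
  then have "interior (convex hull {A, B, C}) \<noteq> {}"
    by (subst interior_convex_hull_eq_empty) simp_all
  then show ?thesis
    using convex_closure_interior[of "convex hull {A, B, C}"] closure_subset by auto
qed

text \<open>Side-side-side. The linear map \<open>L\<close> sends \<open>Q - P\<close> to
  \<open>u\<close> and \<open>R - P\<close> to \<open>v\<close>; it preserves norms because the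
  three side lengths fix all inner products.\<close>

lemma congruent_triangles:
  assumes D: "wedge (Q - P) (R - P) \<noteq> 0"
    and "dist P Q = norm u" "dist P R = norm v" "dist Q R = norm (u - v)"
  shows "congruent_sets (convex hull {P, Q, R}) (convex hull {p, p + u, p + v})"
proof -
  define q r where "q = Q - P" and "r = R - P"
  define L where "L z = (wedge z r / wedge q r) *\<^sub>R u + (wedge q z / wedge q r) *\<^sub>R v" for z
  have D': "wedge q r \<noteq> 0" using D by (simp add: q_def r_def)
  have n: "(norm q)\<^sup>2 = (norm u)\<^sup>2" "(norm r)\<^sup>2 = (norm v)\<^sup>2" "(norm (q - r))\<^sup>2 = (norm (u - v))\<^sup>2"
    using assms by (simp_all add: q_def r_def dist_norm norm_minus_commute)
  \<comment> \<open>Polarization: the inner product is replaced by side lengths, so that rewriting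
    with \<open>n\<close> identifies both norms.\<close>
  have N: "(norm (x *\<^sub>R a + y *\<^sub>R b))\<^sup>2 =
      x\<^sup>2 * (norm a)\<^sup>2 + x * y * ((norm a)\<^sup>2 + (norm b)\<^sup>2 - (norm (a - b))\<^sup>2) + y\<^sup>2 * (norm b)\<^sup>2"
    for x y and a b :: "real ^ 2"
    unfolding power2_norm_eq_inner by (simp add: inner_2 power2_eq_square algebra_simps)
  have "norm (L z) = norm z" for z
  proof -
    have "(norm (L z))\<^sup>2 = (norm z)\<^sup>2"
      by (subst Cramer_2[OF D', of z]) (simp only: L_def N n)
    then show ?thesis by (simp add: power2_eq_iff_nonneg)
  qed
  moreover have lin: "linear L"
    by (rule linearI) (simp_all add: L_def wedge_def algebra_simps add_divide_distrib diff_divide_distrib)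
  ultimately have "dist ((p - L P) + L x) ((p - L P) + L y) = dist x y" for x y
    by (simp add: dist_norm flip: linear_diff)
  moreover have "(\<lambda>z. (p - L P) + L z) ` (convex hull {P, Q, R}) = convex hull {p, p + u, p + v}"
  proof -
    have Lq: "L q = u" "L r = v" using D' by (auto simp: L_def wedge_def)
    have *: "(p - L P) + L Q = p + u" "(p - L P) + L R = p + v"
      using Lq by (simp_all add: q_def r_def linear_diff[OF lin] algebra_simps)
    have "(\<lambda>z. (p - L P) + L z) ` (convex hull {P, Q, R})
        = (\<lambda>z. (p - L P) + z) ` (L ` (convex hull {P, Q, R}))" by (simp add: image_image)
    also have "\<dots> = convex hull ((\<lambda>z. (p - L P) + z) ` (L ` {P, Q, R}))"
      by (simp only: convex_hull_linear_image[OF lin] convex_hull_translation)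
    also have "(\<lambda>z. (p - L P) + z) ` (L ` {P, Q, R}) = {p, p + u, p + v}"
      by (simp only: image_insert image_empty * diff_add_cancel)
    finally show ?thesis .
  qed
  ultimately show ?thesis
    unfolding congruent_sets_def by (intro exI[of _ "\<lambda>z. (p - L P) + L z"]) simp
qed

section \<open>Lattice tilings\<close>

text \<open>Lengths are counted in tile edges: \<open>u\<close> and \<open>v\<close> are the edges
  of a single tile at one vertex, so a natural \<open>n\<close> is the number of tiles along a
  side.\<close>

definition tri :: "real ^ 2 \<Rightarrow> real ^ 2 \<Rightarrow> real ^ 2 \<Rightarrow> real \<Rightarrow> (real ^ 2) set" where
  "tri p u v n = {p + x *\<^sub>R u + y *\<^sub>R v |x y. 0 \<le> x \<and> 0 \<le> y \<and> x + y \<le> n}"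

definition par :: "real ^ 2 \<Rightarrow> real ^ 2 \<Rightarrow> real ^ 2 \<Rightarrow> real \<Rightarrow> real \<Rightarrow> (real ^ 2) set" where
  "par p u v m n = {p + x *\<^sub>R u + y *\<^sub>R v |x y. 0 \<le> x \<and> x \<le> m \<and> 0 \<le> y \<and> y \<le> n}"

lemma hull_eq_tri:
  assumes "0 < n"
  shows "convex hull {p, p + n *\<^sub>R u, p + n *\<^sub>R v} = tri p u v n"
proof (intro set_eqI iffI)
  fix z assume "z \<in> convex hull {p, p + n *\<^sub>R u, p + n *\<^sub>R v}"
  then obtain i j k where ijk: "0 \<le> i" "0 \<le> j" "0 \<le> k" "i + j + k = 1"
    and z: "z = i *\<^sub>R p + j *\<^sub>R (p + n *\<^sub>R u) + k *\<^sub>R (p + n *\<^sub>R v)"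
    unfolding convex_hull_3 by blast
  have "z = (i + j + k) *\<^sub>R p + (j * n) *\<^sub>R u + (k * n) *\<^sub>R v" by (simp add: z algebra_simps)
  moreover have "(j + k) * n \<le> 1 * n" using ijk assms by (intro mult_right_mono) auto
  ultimately show "z \<in> tri p u v n"
    unfolding tri_def using ijk assms
    by (intro CollectI exI[of _ "j * n"] exI[of _ "k * n"]) (simp add: distrib_right)
next
  fix z assume "z \<in> tri p u v n"
  then obtain x y where xy: "0 \<le> x" "0 \<le> y" "x + y \<le> n" "z = p + x *\<^sub>R u + y *\<^sub>R v"
    unfolding tri_def by blast
  have "z = (1 - x / n - y / n) *\<^sub>R p + (x / n) *\<^sub>R (p + n *\<^sub>R u) + (y / n) *\<^sub>R (p + n *\<^sub>R v)"
    using xy assms by (simp add: algebra_simps)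
  moreover have "(x + y) / n \<le> 1" using xy(3) assms by simp
  then have "0 \<le> 1 - x / n - y / n" by (simp add: add_divide_distrib)
  ultimately show "z \<in> convex hull {p, p + n *\<^sub>R u, p + n *\<^sub>R v}"
    unfolding convex_hull_3 using xy assms
    by (intro CollectI exI[of _ "1 - x / n - y / n"] exI[of _ "x / n"] exI[of _ "y / n"]) simp
qed

text \<open>The separating line is \<open>i * x + j * y = k\<close> in the coordinates given by
  \<open>u\<close> and \<open>v\<close>.\<close>

lemma nonoverlapping_coords:
  assumes D: "wedge u v \<noteq> 0" and nz: "i \<noteq> 0 \<or> j \<noteq> 0"
    and K: "\<And>z. z \<in> K \<Longrightarrow> \<exists>x y. z = p + x *\<^sub>R u + y *\<^sub>R v \<and> i * x + j * y \<le> k"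
    and L: "\<And>z. z \<in> L \<Longrightarrow> \<exists>x y. z = p + x *\<^sub>R u + y *\<^sub>R v \<and> k \<le> i * x + j * y"
  shows "nonoverlapping K L"
proof -
  \<comment> \<open>The two perpendiculars divided by the determinant form the basis dual to
    \<open>u\<close>, \<open>v\<close>, so \<open>w\<close> evaluates \<open>i * x + j * y\<close>
    at \<open>z - p\<close>.\<close>
  define w where "w = (1 / wedge u v) *\<^sub>R
    (i *\<^sub>R vector [v $ 2, - (v $ 1)] + j *\<^sub>R vector [- (u $ 2), u $ 1] :: real ^ 2)"
  have w: "w \<bullet> u = i" "w \<bullet> v = j"
  proof -
    have "w \<bullet> u = (1 / wedge u v) * (i * wedge u v)" "w \<bullet> v = (1 / wedge u v) * (j * wedge u v)"
      by (simp_all add: w_def inner_2 wedge_def algebra_simps)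
    then show "w \<bullet> u = i" "w \<bullet> v = j" using D by simp_all
  qed
  show ?thesis
  proof (rule nonoverlapping_line)
    show "w \<noteq> 0" using w nz by auto
    show "w \<bullet> z = w \<bullet> p + k" if zK: "z \<in> K" and zL: "z \<in> L" for z
    proof -
      have eq: "w \<bullet> (p + x *\<^sub>R u + y *\<^sub>R v) = w \<bullet> p + (i * x + j * y)" for x y
        by (simp add: inner_add_right w mult.commute)
      have "w \<bullet> z \<le> w \<bullet> p + k" using K[OF zK] eq by force
      moreover have "w \<bullet> p + k \<le> w \<bullet> z" using L[OF zL] eq by force
      ultimately show ?thesis by simp
    qed
  qed
qed

text \<open>The second congruence is for the tile turned by 180 degrees, which fills the other half
  of each unit parallelogram.\<close>

definition lattice_tile :: "(real ^ 2) set \<Rightarrow> real ^ 2 \<Rightarrow> real ^ 2 \<Rightarrow> bool" where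
  "lattice_tile T u v \<longleftrightarrow> T \<noteq> {} \<and> T \<subseteq> closure (interior T) \<and> wedge u v \<noteq> 0 \<and>
    (\<forall>p. congruent_sets T (convex hull {p, p + u, p + v}) \<and>
         congruent_sets T (convex hull {p, p - u, p - v}))"

lemma lattice_tileD:
  assumes "lattice_tile T u v"
  shows "T \<noteq> {}" "T \<subseteq> closure (interior T)" "wedge u v \<noteq> 0"
    "congruent_sets T (convex hull {p, p + u, p + v})"
    "congruent_sets T (convex hull {p, p - u, p - v})"
  using assms by (auto simp: lattice_tile_def)

lemma dissects_tri_1:
  assumes "lattice_tile T u v" shows "dissects T 1 (tri p u v 1)"
  using dissects_single[OF lattice_tileD(4)[OF assms], of p] hull_eq_tri[of 1 p u v] by simp

text \<open>The diagonal \<open>x + y = 1\<close> cuts the unit parallelogram into a tile and its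
  half-turn.\<close>

lemma dissects_par_1:
  assumes tile: "lattice_tile T u v"
  shows "dissects T 2 (par p u v 1 1)"
proof -
  have "par p u v 1 1 = tri p u v 1 \<union> tri (p + u + v) (- u) (- v) 1"
  proof (intro set_eqI iffI)
    fix z assume "z \<in> par p u v 1 1"
    then obtain x y where xy: "0 \<le> x" "x \<le> 1" "0 \<le> y" "y \<le> 1" "z = p + x *\<^sub>R u + y *\<^sub>R v"
      unfolding par_def by blast
    show "z \<in> tri p u v 1 \<union> tri (p + u + v) (- u) (- v) 1"
    proof (cases "x + y \<le> 1")
      case True
      then show ?thesis using xy by (auto simp: tri_def)
    next
      case False
      have "z = p + u + v + (1 - x) *\<^sub>R (- u) + (1 - y) *\<^sub>R (- v)"
        using xy by (simp add: algebra_simps)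
      then have "z \<in> tri (p + u + v) (- u) (- v) 1"
        unfolding tri_def using xy False
        by (intro CollectI exI[of _ "1 - x"] exI[of _ "1 - y"]) simp
      then show ?thesis by simp
    qed
  next
    fix z assume "z \<in> tri p u v 1 \<union> tri (p + u + v) (- u) (- v) 1"
    then show "z \<in> par p u v 1 1"
    proof
      assume "z \<in> tri p u v 1"
      then show ?thesis by (force simp: tri_def par_def)
    next
      assume "z \<in> tri (p + u + v) (- u) (- v) 1"
      then obtain x y where xy: "0 \<le> x" "0 \<le> y" "x + y \<le> 1"
        "z = p + u + v + x *\<^sub>R (- u) + y *\<^sub>R (- v)" unfolding tri_def by blast
      have "z = p + (1 - x) *\<^sub>R u + (1 - y) *\<^sub>R v" using xy by (simp add: algebra_simps)
      then show ?thesis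
        unfolding par_def using xy by (intro CollectI exI[of _ "1 - x"] exI[of _ "1 - y"]) simp
    qed
  qed
  moreover have "nonoverlapping (tri p u v 1) (tri (p + u + v) (- u) (- v) 1)"
  proof (rule nonoverlapping_coords[OF lattice_tileD(3)[OF tile], of 1 1 _ p 1])
    show "\<exists>x y. z = p + x *\<^sub>R u + y *\<^sub>R v \<and> 1 * x + 1 * y \<le> 1" if "z \<in> tri p u v 1" for z
      using that by (auto simp: tri_def)
    show "\<exists>x y. z = p + x *\<^sub>R u + y *\<^sub>R v \<and> 1 \<le> 1 * x + 1 * y"
      if "z \<in> tri (p + u + v) (- u) (- v) 1" for z
    proof -
      from that obtain x y where xy: "0 \<le> x" "0 \<le> y" "x + y \<le> 1"
        "z = p + u + v + x *\<^sub>R (- u) + y *\<^sub>R (- v)" unfolding tri_def by blast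
      then show ?thesis
        by (intro exI[of _ "1 - x"] exI[of _ "1 - y"]) (simp add: algebra_simps)
    qed
  qed simp
  moreover have "dissects T 1 (tri (p + u + v) (- u) (- v) 1)"
    using dissects_single[OF lattice_tileD(5)[OF tile], of "p + u + v"] hull_eq_tri[of 1 "p + u + v" "- u" "- v"] by simp
  ultimately show ?thesis
    using dissects_Un[OF lattice_tileD(1,2)[OF tile] dissects_tri_1[OF tile]] by (metis one_add_one)
qed

lemma dissects_row:
  assumes tile: "lattice_tile T u v" and "0 < m"
  shows "dissects T (2 * m) (par p u v (real m) 1)"
  using assms(2)
proof (induction m rule: nat_induct_non_zero)
  case 1
  then show ?case using dissects_par_1[OF tile] by simp
next
  case (Suc m)
  have "par p u v (real (Suc m)) 1 = par p u v (real m) 1 \<union> par (p + real m *\<^sub>R u) u v 1 1"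
  proof (intro set_eqI iffI)
    fix z assume "z \<in> par p u v (real (Suc m)) 1"
    then obtain x y where xy: "0 \<le> x" "x \<le> real m + 1" "0 \<le> y" "y \<le> 1" "z = p + x *\<^sub>R u + y *\<^sub>R v"
      unfolding par_def by auto
    have "z = p + real m *\<^sub>R u + (x - real m) *\<^sub>R u + y *\<^sub>R v" using xy by (simp add: algebra_simps)
    moreover have "0 \<le> x - real m \<and> x - real m \<le> 1 \<or> x \<le> real m" using xy by linarith
    ultimately show "z \<in> par p u v (real m) 1 \<union> par (p + real m *\<^sub>R u) u v 1 1"
      using xy unfolding par_def by blast
  next
    fix z assume "z \<in> par p u v (real m) 1 \<union> par (p + real m *\<^sub>R u) u v 1 1"
    then show "z \<in> par p u v (real (Suc m)) 1"
    proof
      assume "z \<in> par p u v (real m) 1"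
      then show ?thesis by (force simp: par_def)
    next
      assume "z \<in> par (p + real m *\<^sub>R u) u v 1 1"
      then obtain x y where xy: "0 \<le> x" "x \<le> 1" "0 \<le> y" "y \<le> 1"
        "z = p + real m *\<^sub>R u + x *\<^sub>R u + y *\<^sub>R v" unfolding par_def by blast
      then show ?thesis unfolding par_def
        by (intro CollectI exI[of _ "real m + x"] exI[of _ y]) (simp add: algebra_simps)
    qed
  qed
  moreover have "nonoverlapping (par p u v (real m) 1) (par (p + real m *\<^sub>R u) u v 1 1)"
  proof (rule nonoverlapping_coords[OF lattice_tileD(3)[OF tile], of 1 0 _ p "real m"])
    show "\<exists>x y. z = p + x *\<^sub>R u + y *\<^sub>R v \<and> 1 * x + 0 * y \<le> real m"
      if "z \<in> par p u v (real m) 1" for z using that by (auto simp: par_def)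
    show "\<exists>x y. z = p + x *\<^sub>R u + y *\<^sub>R v \<and> real m \<le> 1 * x + 0 * y"
      if "z \<in> par (p + real m *\<^sub>R u) u v 1 1" for z
    proof -
      from that obtain x y where xy: "0 \<le> x" "z = p + real m *\<^sub>R u + x *\<^sub>R u + y *\<^sub>R v"
        unfolding par_def by blast
      then show ?thesis
        by (intro exI[of _ "real m + x"] exI[of _ y]) (simp add: algebra_simps)
    qed
  qed simp
  ultimately show ?case
    using dissects_Un[OF lattice_tileD(1,2)[OF tile] Suc.IH dissects_par_1[OF tile]]
    by (simp add: add.commute)
qed

lemma dissects_par:
  assumes tile: "lattice_tile T u v" and "0 < m" "0 < n"
  shows "dissects T (2 * m * n) (par p u v (real m) (real n))"
  using assms(3)
proof (induction n rule: nat_induct_non_zero)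
  case 1
  then show ?case using dissects_row[OF tile assms(2)] by simp
next
  case (Suc n)
  have "par p u v (real m) (real (Suc n)) =
      par p u v (real m) (real n) \<union> par (p + real n *\<^sub>R v) u v (real m) 1"
  proof (intro set_eqI iffI)
    fix z assume "z \<in> par p u v (real m) (real (Suc n))"
    then obtain x y where xy: "0 \<le> x" "x \<le> real m" "0 \<le> y" "y \<le> real n + 1"
      "z = p + x *\<^sub>R u + y *\<^sub>R v" unfolding par_def by auto
    have "z = p + real n *\<^sub>R v + x *\<^sub>R u + (y - real n) *\<^sub>R v" using xy by (simp add: algebra_simps)
    moreover have "0 \<le> y - real n \<and> y - real n \<le> 1 \<or> y \<le> real n" using xy by linarith
    ultimately show "z \<in> par p u v (real m) (real n) \<union> par (p + real n *\<^sub>R v) u v (real m) 1"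
      using xy unfolding par_def by blast
  next
    fix z assume "z \<in> par p u v (real m) (real n) \<union> par (p + real n *\<^sub>R v) u v (real m) 1"
    then show "z \<in> par p u v (real m) (real (Suc n))"
    proof
      assume "z \<in> par p u v (real m) (real n)"
      then show ?thesis by (force simp: par_def)
    next
      assume "z \<in> par (p + real n *\<^sub>R v) u v (real m) 1"
      then obtain x y where xy: "0 \<le> x" "x \<le> real m" "0 \<le> y" "y \<le> 1"
        "z = p + real n *\<^sub>R v + x *\<^sub>R u + y *\<^sub>R v" unfolding par_def by blast
      then show ?thesis unfolding par_def
        by (intro CollectI exI[of _ x] exI[of _ "real n + y"]) (simp add: algebra_simps)
    qed
  qed
  moreover have "nonoverlapping (par p u v (real m) (real n)) (par (p + real n *\<^sub>R v) u v (real m) 1)"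
  proof (rule nonoverlapping_coords[OF lattice_tileD(3)[OF tile], of 0 1 _ p "real n"])
    show "\<exists>x y. z = p + x *\<^sub>R u + y *\<^sub>R v \<and> 0 * x + 1 * y \<le> real n"
      if "z \<in> par p u v (real m) (real n)" for z using that by (auto simp: par_def)
    show "\<exists>x y. z = p + x *\<^sub>R u + y *\<^sub>R v \<and> real n \<le> 0 * x + 1 * y"
      if "z \<in> par (p + real n *\<^sub>R v) u v (real m) 1" for z
    proof -
      from that obtain x y where xy: "0 \<le> y" "z = p + real n *\<^sub>R v + x *\<^sub>R u + y *\<^sub>R v"
        unfolding par_def by blast
      then show ?thesis
        by (intro exI[of _ x] exI[of _ "real n + y"]) (simp add: algebra_simps)
    qed
  qed simp
  ultimately show ?case
    using dissects_Un[OF lattice_tileD(1,2)[OF tile] Suc.IH dissects_row[OF tile assms(2)]]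
    by (simp add: algebra_simps)
qed

text \<open>The strip \<open>x \<le> 1\<close> consists of a column of \<open>n\<close> unit
  parallelograms and one tile at its tip. The rest is a triangle of size \<open>n\<close> based at
  \<open>p + u\<close>, which is why the induction varies \<open>p\<close>. The count is the step
  from one square to the next.\<close>

lemma dissects_tri:
  assumes tile: "lattice_tile T u v" and "0 < n"
  shows "dissects T (n\<^sup>2) (tri p u v (real n))"
  using assms(2)
proof (induction n arbitrary: p rule: nat_induct_non_zero)
  case 1
  then show ?case using dissects_tri_1[OF tile] by simp
next
  case (Suc n)
  define K1 K2 K3 where "K1 = par p u v 1 (real n)" and "K2 = tri (p + real n *\<^sub>R v) u v 1"
    and "K3 = tri (p + u) u v (real n)"
  have K1: "\<exists>x y. z = p + x *\<^sub>R u + y *\<^sub>R v \<and> 0 \<le> x \<and> x \<le> 1 \<and> 0 \<le> y \<and> y \<le> real n"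
    if "z \<in> K1" for z using that by (auto simp: K1_def par_def)
  have K2: "\<exists>x y. z = p + x *\<^sub>R u + y *\<^sub>R v \<and> 0 \<le> x \<and> x \<le> 1 \<and> real n \<le> y \<and> x + y \<le> real n + 1"
    if "z \<in> K2" for z
  proof -
    from that obtain x y where xy: "0 \<le> x" "0 \<le> y" "x + y \<le> 1"
      "z = p + real n *\<^sub>R v + x *\<^sub>R u + y *\<^sub>R v" unfolding K2_def tri_def by blast
    then show ?thesis by (intro exI[of _ x] exI[of _ "real n + y"]) (simp add: algebra_simps)
  qed
  have K3: "\<exists>x y. z = p + x *\<^sub>R u + y *\<^sub>R v \<and> 1 \<le> x \<and> 0 \<le> y \<and> x + y \<le> real n + 1"
    if "z \<in> K3" for z
  proof -
    from that obtain x y where xy: "0 \<le> x" "0 \<le> y" "x + y \<le> real n"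
      "z = p + u + x *\<^sub>R u + y *\<^sub>R v" unfolding K3_def tri_def by blast
    then show ?thesis by (intro exI[of _ "1 + x"] exI[of _ y]) (simp add: algebra_simps)
  qed
  have eq: "tri p u v (real (Suc n)) = (K1 \<union> K2) \<union> K3"
  proof (intro set_eqI iffI)
    fix z assume "z \<in> tri p u v (real (Suc n))"
    then obtain x y where xy: "0 \<le> x" "0 \<le> y" "x + y \<le> real n + 1" "z = p + x *\<^sub>R u + y *\<^sub>R v"
      unfolding tri_def by auto
    consider "x \<le> 1" "y \<le> real n" | "x \<le> 1" "real n \<le> y" | "1 \<le> x" by linarith
    then show "z \<in> (K1 \<union> K2) \<union> K3"
    proof cases
      case 1
      then show ?thesis using xy by (auto simp: K1_def par_def)
    next
      case 2
      have "z = p + real n *\<^sub>R v + x *\<^sub>R u + (y - real n) *\<^sub>R v" using xy by (simp add: algebra_simps)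
      moreover have "0 \<le> y - real n" "x + (y - real n) \<le> 1" using 2 xy by simp_all
      ultimately have "z \<in> K2" using xy unfolding K2_def tri_def by blast
      then show ?thesis by simp
    next
      case 3
      have "z = p + u + (x - 1) *\<^sub>R u + y *\<^sub>R v" using xy by (simp add: algebra_simps)
      moreover have "0 \<le> x - 1" "(x - 1) + y \<le> real n" using 3 xy by simp_all
      ultimately have "z \<in> K3" using xy unfolding K3_def tri_def by blast
      then show ?thesis by simp
    qed
  next
    fix z assume "z \<in> (K1 \<union> K2) \<union> K3"
    then consider "z \<in> K1" | "z \<in> K2" | "z \<in> K3" by blast
    then obtain x y where "z = p + x *\<^sub>R u + y *\<^sub>R v" "0 \<le> x" "0 \<le> y" "x + y \<le> real (Suc n)"
    proof cases
      case 1
      from K1[OF this] obtain x y where "z = p + x *\<^sub>R u + y *\<^sub>R v" "0 \<le> x" "x \<le> 1" "0 \<le> y" "y \<le> real n"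
        by blast
      then show thesis using that[of x y] by linarith
    next
      case 2
      from K2[OF this] obtain x y where "z = p + x *\<^sub>R u + y *\<^sub>R v" "0 \<le> x" "real n \<le> y" "x + y \<le> real n + 1"
        by blast
      then show thesis using that[of x y] by linarith
    next
      case 3
      from K3[OF this] obtain x y where "z = p + x *\<^sub>R u + y *\<^sub>R v" "1 \<le> x" "0 \<le> y" "x + y \<le> real n + 1"
        by blast
      then show thesis using that[of x y] by linarith
    qed
    then show "z \<in> tri p u v (real (Suc n))" unfolding tri_def by blast
  qed
  have "nonoverlapping K1 K2"
  proof (rule nonoverlapping_coords[OF lattice_tileD(3)[OF tile], of 0 1 _ p "real n"])
    show "\<exists>x y. z = p + x *\<^sub>R u + y *\<^sub>R v \<and> 0 * x + 1 * y \<le> real n" if "z \<in> K1" for z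
      using K1[OF that] by auto
    show "\<exists>x y. z = p + x *\<^sub>R u + y *\<^sub>R v \<and> real n \<le> 0 * x + 1 * y" if "z \<in> K2" for z
      using K2[OF that] by auto
  qed simp
  then have "dissects T (2 * n + 1) (K1 \<union> K2)"
    using dissects_Un[OF lattice_tileD(1,2)[OF tile] dissects_par[OF tile, of 1 n p]
      dissects_tri_1[OF tile, of "p + real n *\<^sub>R v"]] Suc.hyps
    by (simp add: K1_def K2_def)
  moreover have "nonoverlapping (K1 \<union> K2) K3"
  proof (rule nonoverlapping_coords[OF lattice_tileD(3)[OF tile], of 1 0 _ p 1])
    show "\<exists>x y. z = p + x *\<^sub>R u + y *\<^sub>R v \<and> 1 * x + 0 * y \<le> 1" if "z \<in> K1 \<union> K2" for z
      using that K1[of z] K2[of z] by auto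
    show "\<exists>x y. z = p + x *\<^sub>R u + y *\<^sub>R v \<and> 1 \<le> 1 * x + 0 * y" if "z \<in> K3" for z
      using K3[OF that] by auto
  qed simp
  moreover have "dissects T (n\<^sup>2) K3" using Suc.IH by (simp add: K3_def)
  ultimately have "dissects T (2 * n + 1 + n\<^sup>2) (tri p u v (real (Suc n)))"
    unfolding eq using dissects_Un[OF lattice_tileD(1,2)[OF tile]] by blast
  moreover have "2 * n + 1 + n\<^sup>2 = (Suc n)\<^sup>2" by (simp add: power2_eq_square)
  ultimately show ?case by simp
qed

section \<open>Cutting along a segment from a vertex or along a diagonal\<close>

lemma triangle_split:
  fixes A B C D :: "real ^ 2"
  assumes "D \<in> closed_segment B C"
  shows "convex hull {A, B, C} = convex hull {A, B, D} \<union> convex hull {A, D, C}"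
proof
  obtain t where t: "0 \<le> t" "t \<le> 1" "D = (1 - t) *\<^sub>R B + t *\<^sub>R C"
    using assms by (auto simp: closed_segment_def)
  show "convex hull {A, B, C} \<subseteq> convex hull {A, B, D} \<union> convex hull {A, D, C}"
  proof
    fix z assume "z \<in> convex hull {A, B, C}"
    then obtain i j k where ijk: "0 \<le> i" "0 \<le> j" "0 \<le> k" "i + j + k = 1"
      and z: "z = i *\<^sub>R A + j *\<^sub>R B + k *\<^sub>R C" unfolding convex_hull_3 by blast
    show "z \<in> convex hull {A, B, D} \<union> convex hull {A, D, C}"
    \<comment> \<open>In barycentric coordinates the line through \<open>A\<close> and
      \<open>D\<close> is \<open>k * (1 - t) = j * t\<close>; the inequality puts \<open>z\<close>
      on the side of \<open>B\<close>. The coefficient \<open>m\<close> of \<open>D\<close> is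
      chosen to absorb the whole share of the vertex left out.\<close>
    proof (cases "k * (1 - t) \<le> j * t")
      case True
      show ?thesis
      proof (cases "t = 0")
        case True
        then have "D = B" using t(3) by simp
        then show ?thesis using ijk z unfolding convex_hull_3 by blast
      next
        case False
        define m where "m = k / t"
        have k: "k = m * t" using False by (simp add: m_def)
        have "0 \<le> m" using ijk t by (simp add: m_def)
        moreover have "m * (1 - t) * t \<le> j * t" using True k by (simp add: algebra_simps)
        then have "0 \<le> j - m * (1 - t)" using False t by simp
        moreover have "z = i *\<^sub>R A + (j - m * (1 - t)) *\<^sub>R B + m *\<^sub>R D"
          by (simp add: z k t(3) algebra_simps)
        moreover have "i + (j - m * (1 - t)) + m = 1" using ijk k by (simp add: algebra_simps)
        ultimately have "z \<in> convex hull {A, B, D}" using ijk unfolding convex_hull_3 by blast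
        then show ?thesis by simp
      qed
    next
      case F: False
      show ?thesis
      proof (cases "t = 1")
        case True
        then have "D = C" using t(3) by simp
        then show ?thesis using ijk z unfolding convex_hull_3 by blast
      next
        case False
        define m where "m = j / (1 - t)"
        have j: "j = m * (1 - t)" using False by (simp add: m_def)
        have "0 \<le> m" using ijk t by (simp add: m_def)
        moreover have "m * t * (1 - t) \<le> k * (1 - t)" using F j by (simp add: algebra_simps)
        then have "0 \<le> k - m * t" using False t by simp
        moreover have "z = i *\<^sub>R A + m *\<^sub>R D + (k - m * t) *\<^sub>R C"
          by (simp add: z j t(3) algebra_simps)
        moreover have "i + m + (k - m * t) = 1" using ijk j by (simp add: algebra_simps)
        ultimately have "z \<in> convex hull {A, D, C}" using ijk unfolding convex_hull_3 by blast
        then show ?thesis by simp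
      qed
    qed
  qed
  have "D \<in> convex hull {B, C}" using assms by (simp add: segment_convex_hull)
  moreover have "convex hull {B, C} \<subseteq> convex hull {A, B, C}" by (intro hull_mono) auto
  ultimately have "D \<in> convex hull {A, B, C}" by blast
  then show "convex hull {A, B, D} \<union> convex hull {A, D, C} \<subseteq> convex hull {A, B, C}"
    by (intro Un_least hull_minimal) (auto intro: hull_inc)
qed

lemma inner_perp: "(vector [- (u $ 2), u $ 1] :: real ^ 2) \<bullet> z = wedge u z"
  by (simp add: inner_2 wedge_def)

lemma triangle_split_nonoverlapping:
  assumes "D \<in> closed_segment B C"
  shows "nonoverlapping (convex hull {A, B, D}) (convex hull {A, D, C})"
proof (cases "A = D")
  case True
  \<comment> \<open>With \<open>A = D\<close> the first triangle collapses to the segment from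
    \<open>A\<close> to \<open>B\<close>, which lies on a line. If also \<open>B = A\<close>, any
    nonzero normal serves.\<close>
  define w :: "real ^ 2" where
    "w = (if B = A then vector [1, 0] else vector [- ((B - A) $ 2), (B - A) $ 1])"
  show ?thesis
  proof (rule nonoverlapping_line)
    show "w \<noteq> 0" by (auto simp: w_def vec_eq_2)
    have w: "w \<bullet> B = w \<bullet> A" by (auto simp: w_def inner_2 algebra_simps)
    show "w \<bullet> z = w \<bullet> A" if zh: "z \<in> convex hull {A, B, D}" for z
    proof -
      obtain i j k where "i + j + k = 1" "z = i *\<^sub>R A + j *\<^sub>R B + k *\<^sub>R D"
        using zh unfolding convex_hull_3 by blast
      moreover have "i * x + j * x + k * x = (i + j + k) * x" for x :: real
        by (simp add: distrib_right)
      ultimately show ?thesis using True w by (simp add: inner_add_right)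
    qed
  qed
next
  case False
  obtain t where t: "0 \<le> t" "t \<le> 1" "D = (1 - t) *\<^sub>R B + t *\<^sub>R C"
    using assms by (auto simp: closed_segment_def)
  define w :: "real ^ 2" where "w = vector [- ((D - A) $ 2), (D - A) $ 1]"
  define b c where "b = w \<bullet> (B - A)" and "c = w \<bullet> (C - A)"
  have wD: "w \<bullet> (D - A) = 0" unfolding w_def inner_perp by (simp add: wedge_def)
  have "D - A = (1 - t) *\<^sub>R (B - A) + t *\<^sub>R (C - A)" by (simp add: t(3) algebra_simps)
  then have "(1 - t) * b + t * c = 0" using wD by (simp add: b_def c_def inner_add_right)
  \<comment> \<open>\<open>B\<close> and \<open>C\<close> are not strictly on the same side of the
    line through \<open>A\<close> and \<open>D\<close>, since \<open>D\<close> lies between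
    them.\<close>
  have bc: "b * c \<le> 0"
  proof (cases "t = 1")
    case True
    then show ?thesis using \<open>(1 - t) * b + t * c = 0\<close> by simp
  next
    case False
    have "(1 - t) * (b * c) = ((1 - t) * b + t * c) * c - t * c\<^sup>2"
      by (simp add: power2_eq_square algebra_simps)
    also have "\<dots> \<le> 0" using \<open>(1 - t) * b + t * c = 0\<close> t by simp
    finally show ?thesis using False t by (simp add: mult_le_0_iff)
  qed
  show ?thesis
  proof (rule nonoverlapping_line)
    show "w \<noteq> 0" using False by (auto simp: w_def vec_eq_2)
    show "w \<bullet> z = w \<bullet> A" if z1: "z \<in> convex hull {A, B, D}" and z2: "z \<in> convex hull {A, D, C}" for z
    proof -
      obtain i j k where 1: "0 \<le> j" "i + j + k = 1" "z = i *\<^sub>R A + j *\<^sub>R B + k *\<^sub>R D"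
        using z1 unfolding convex_hull_3 by blast
      obtain i' j' k' where 2: "0 \<le> k'" "i' + j' + k' = 1" "z = i' *\<^sub>R A + j' *\<^sub>R D + k' *\<^sub>R C"
        using z2 unfolding convex_hull_3 by blast
      have "z - A = i *\<^sub>R A + j *\<^sub>R B + k *\<^sub>R D - (i + j + k) *\<^sub>R A" using 1 by simp
      then have "z - A = j *\<^sub>R (B - A) + k *\<^sub>R (D - A)" by (simp add: algebra_simps)
      then have e1: "w \<bullet> (z - A) = j * b" by (simp add: inner_add_right wD b_def)
      have "z - A = i' *\<^sub>R A + j' *\<^sub>R D + k' *\<^sub>R C - (i' + j' + k') *\<^sub>R A" using 2 by simp
      then have "z - A = j' *\<^sub>R (D - A) + k' *\<^sub>R (C - A)" by (simp add: algebra_simps)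
      then have e2: "w \<bullet> (z - A) = k' * c" by (simp add: inner_add_right wD c_def)
      \<comment> \<open>At a common point the same value is a nonnegative multiple of
        \<open>b\<close> and of \<open>c\<close>, which have opposite signs or vanish; so its square
        is at most 0.\<close>
      have "(w \<bullet> (z - A))\<^sup>2 = (j * k') * (b * c)"
        using e1 e2 by (simp add: power2_eq_square)
      also have "\<dots> \<le> 0" by (rule mult_nonneg_nonpos[OF mult_nonneg_nonneg[OF 1(1) 2(1)] bc])
      finally have "w \<bullet> (z - A) = 0" by simp
      then show ?thesis by (simp add: inner_diff_right)
    qed
  qed
qed

text \<open>The diagonal starts at \<open>p\<close>, matching the form in which
  \<open>dissects_seven_pieces\<close> takes its two parallelograms.\<close>

lemma par_eq_triangles:
  assumes "0 < m" "0 < n"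
  shows "par p u v m n = convex hull {p, p + m *\<^sub>R u, p + m *\<^sub>R u + n *\<^sub>R v} \<union>
    convex hull {p, p + n *\<^sub>R v, p + m *\<^sub>R u + n *\<^sub>R v}"
proof -
  have h: "convex hull {p, p + a, p + b} = tri p a b 1" for a b
    using hull_eq_tri[of 1 p a b] by simp
  have "par p u v m n = tri p (m *\<^sub>R u) (m *\<^sub>R u + n *\<^sub>R v) 1 \<union> tri p (n *\<^sub>R v) (m *\<^sub>R u + n *\<^sub>R v) 1"
  proof (intro set_eqI iffI)
    fix z assume "z \<in> par p u v m n"
    then obtain x y where xy: "0 \<le> x" "x \<le> m" "0 \<le> y" "y \<le> n" "z = p + x *\<^sub>R u + y *\<^sub>R v"
      unfolding par_def by blast
    define a b where "a = x / m" and "b = y / n"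
    have ab: "0 \<le> a" "a \<le> 1" "0 \<le> b" "b \<le> 1" "z = p + (a * m) *\<^sub>R u + (b * n) *\<^sub>R v"
      using xy assms by (simp_all add: a_def b_def)
    show "z \<in> tri p (m *\<^sub>R u) (m *\<^sub>R u + n *\<^sub>R v) 1 \<union> tri p (n *\<^sub>R v) (m *\<^sub>R u + n *\<^sub>R v) 1"
    proof (cases "b \<le> a")
      case True
      have "z = p + (a - b) *\<^sub>R (m *\<^sub>R u) + b *\<^sub>R (m *\<^sub>R u + n *\<^sub>R v)"
        using ab by (simp add: algebra_simps)
      then have "z \<in> tri p (m *\<^sub>R u) (m *\<^sub>R u + n *\<^sub>R v) 1"
        unfolding tri_def using True ab by (intro CollectI exI[of _ "a - b"] exI[of _ b]) simp
      then show ?thesis by simp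
    next
      case False
      have "z = p + (b - a) *\<^sub>R (n *\<^sub>R v) + a *\<^sub>R (m *\<^sub>R u + n *\<^sub>R v)"
        using ab by (simp add: algebra_simps)
      then have "z \<in> tri p (n *\<^sub>R v) (m *\<^sub>R u + n *\<^sub>R v) 1"
        unfolding tri_def using False ab by (intro CollectI exI[of _ "b - a"] exI[of _ a]) simp
      then show ?thesis by simp
    qed
  next
    fix z assume "z \<in> tri p (m *\<^sub>R u) (m *\<^sub>R u + n *\<^sub>R v) 1 \<union> tri p (n *\<^sub>R v) (m *\<^sub>R u + n *\<^sub>R v) 1"
    then obtain x y where xy: "0 \<le> x" "0 \<le> y" "x + y \<le> 1"
      and "z = p + x *\<^sub>R (m *\<^sub>R u) + y *\<^sub>R (m *\<^sub>R u + n *\<^sub>R v) \<or>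
        z = p + x *\<^sub>R (n *\<^sub>R v) + y *\<^sub>R (m *\<^sub>R u + n *\<^sub>R v)"
      unfolding tri_def by blast
    then have "z = p + ((x + y) * m) *\<^sub>R u + (y * n) *\<^sub>R v \<or>
        z = p + (y * m) *\<^sub>R u + ((x + y) * n) *\<^sub>R v"
      by (auto simp: algebra_simps)
    moreover have "(x + y) * m \<le> 1 * m" "y * n \<le> 1 * n" "y * m \<le> 1 * m" "(x + y) * n \<le> 1 * n"
      using xy assms by (intro mult_right_mono; simp)+
    moreover have "0 \<le> (x + y) * m" "0 \<le> y * n" "0 \<le> y * m" "0 \<le> (x + y) * n"
      using xy assms by simp_all
    ultimately show "z \<in> par p u v m n" unfolding par_def mult_1 by blast
  qed
  then show ?thesis using h[of "m *\<^sub>R u" "m *\<^sub>R u + n *\<^sub>R v"] h[of "n *\<^sub>R v" "m *\<^sub>R u + n *\<^sub>R v"]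
    by (simp add: add.assoc)
qed

section \<open>The seven pieces\<close>

text \<open>\<open>H\<close> lies in the interior of \<open>AIK\<close>, so its three neighbours cannot be separated by cuts
  from vertex to side alone; the point \<open>E\<close> where \<open>AH\<close> meets \<open>IK\<close> is auxiliary.\<close>

lemma dissects_seven_pieces:
  fixes A B C D E F G H I J K :: "real ^ 2"
  assumes T: "T \<noteq> {}" "T \<subseteq> closure (interior T)"
    and K: "K \<in> closed_segment A B" and F: "F \<in> closed_segment C B"
    and G: "G \<in> closed_segment K B" and J: "J \<in> closed_segment C K"
    and I: "I \<in> closed_segment C K" and D: "D \<in> closed_segment A C"
    and E: "E \<in> closed_segment I K" and H: "H \<in> closed_segment A E"
    and d1: "dissects T n1 (convex hull {F, G, B})"
    and d2: "dissects T n2 (convex hull {K, G, F} \<union> convex hull {K, J, F})"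
    and d3: "dissects T n3 (convex hull {F, C, J})"
    and d4: "dissects T n4 (convex hull {D, C, I})"
    and d5: "dissects T n5 (convex hull {A, D, I} \<union> convex hull {A, H, I})"
    and d6: "dissects T n6 (convex hull {A, H, K})"
    and d7: "dissects T n7 (convex hull {H, I, K})"
  shows "dissects T (((n4 + n5) + (n6 + n7)) + ((n1 + n2) + n3)) (convex hull {A, B, C})"
proof -
  define h where "h X Y Z = convex hull {X, Y, Z}" for X Y Z :: "real ^ 2"
  have s: "h X Y Z = h X Y W \<union> h X W Z \<and> nonoverlapping (h X Y W) (h X W Z)"
    if "W \<in> closed_segment Y Z" for W X Y Z
    using that triangle_split triangle_split_nonoverlapping by (simp add: h_def)
  have cl: "closed (h X Y Z)" for X Y Z
    by (simp add: h_def compact_imp_closed compact_convex_hull)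
  \<comment> \<open>The successive cuts are \<open>CK\<close>, \<open>KF\<close>, \<open>FG\<close>,
    \<open>FJ\<close>, \<open>AI\<close>, \<open>DI\<close>, \<open>AE\<close>, and then
    \<open>IH\<close> and \<open>KH\<close>.\<close>
  have s1: "h A B C = h A C K \<union> h B C K" "nonoverlapping (h A C K) (h B C K)"
    using s[OF K, of C] by (simp_all add: h_def insert_commute)
  have s2: "h B C K = h C F K \<union> h B F K" "nonoverlapping (h C F K) (h B F K)"
    using s[OF F, of K] by (simp_all add: h_def insert_commute)
  have s3: "h B F K = h F G K \<union> h B F G" "nonoverlapping (h F G K) (h B F G)"
    using s[OF G, of F] by (simp_all add: h_def insert_commute)
  have s4: "h C F K = h C F J \<union> h F J K" "nonoverlapping (h C F J) (h F J K)"
    using s[OF J, of F] by (simp_all add: h_def insert_commute)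
  have s5: "h A C K = h A C I \<union> h A I K" "nonoverlapping (h A C I) (h A I K)"
    using s[OF I, of A] by (simp_all add: h_def insert_commute)
  have s6: "h A C I = h A D I \<union> h C D I" "nonoverlapping (h A D I) (h C D I)"
    using s[OF D, of I] by (simp_all add: h_def insert_commute)
  have s7: "h A I K = h A E I \<union> h A E K" "nonoverlapping (h A E I) (h A E K)"
    using s[OF E, of A] by (simp_all add: h_def insert_commute)
  have s8: "h A E I = h A H I \<union> h E H I" "nonoverlapping (h A H I) (h E H I)"
    using s[OF H, of I] by (simp_all add: h_def insert_commute)
  have s9: "h A E K = h A H K \<union> h E H K" "nonoverlapping (h A H K) (h E H K)"
    using s[OF H, of K] by (simp_all add: h_def insert_commute)
  \<comment> \<open>This goes the other way: the two triangles on either side of \<open>EH\<close>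
    are glued back into the piece \<open>HIK\<close>.\<close>
  have s10: "h H I K = h E H I \<union> h E H K"
    using s[OF E, of H] by (simp add: h_def insert_commute)
  have d: "dissects T n1 (h B F G)" "dissects T n2 (h F G K \<union> h F J K)" "dissects T n3 (h C F J)"
    "dissects T n4 (h C D I)" "dissects T n5 (h A D I \<union> h A H I)" "dissects T n6 (h A H K)"
    "dissects T n7 (h H I K)"
    using d1 d2 d3 d4 d5 d6 d7 by (simp_all add: h_def insert_commute)
  \<comment> \<open>Pieces on opposite sides of an earlier cut do not overlap; the cuts are
    \<open>CK\<close>, \<open>KF\<close>, \<open>AI\<close> and \<open>AE\<close>, in this
    order.\<close>
  note mono = nonoverlapping_mono[OF s1(2)] nonoverlapping_mono[OF s2(2)]
    nonoverlapping_mono[OF s5(2)] nonoverlapping_mono[OF s7(2)]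
  note sym = nonoverlapping_sym
  note U = dissects_Un[OF T]
  note Un = nonoverlapping_Un[OF cl]
  have "nonoverlapping (h F G K \<union> h F J K) (h B F G)"
    by (rule Un[OF s3(2)], rule mono(2)) (use s3 s4 in auto)
  then have "dissects T (n1 + n2) (h B F G \<union> (h F G K \<union> h F J K))"
    by (rule U[OF d(1,2) sym])
  moreover have "nonoverlapping (h B F G \<union> (h F G K \<union> h F J K)) (h C F J)"
    by (intro Un sym[OF s4(2)]; rule sym, rule mono(2)) (use s3 s4 in auto)
  ultimately have "dissects T ((n1 + n2) + n3) (h B F G \<union> (h F G K \<union> h F J K) \<union> h C F J)"
    using U[OF _ d(3)] by blast
  moreover have "h B F G \<union> (h F G K \<union> h F J K) \<union> h C F J = h B C K" using s2 s3 s4 by auto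
  ultimately have right: "dissects T ((n1 + n2) + n3) (h B C K)" by simp
  have "nonoverlapping (h A D I \<union> h A H I) (h C D I)"
    by (rule Un[OF s6(2)], rule sym, rule mono(3)) (use s6 s7 s8 in auto)
  then have d45: "dissects T (n4 + n5) (h C D I \<union> (h A D I \<union> h A H I))"
    by (rule U[OF d(4,5) sym])
  have "nonoverlapping (h E H I \<union> h E H K) (h A H K)"
    by (rule Un[OF _ sym[OF s9(2)]], rule mono(4)) (use s8 s9 in auto)
  then have d67: "dissects T (n6 + n7) (h A H K \<union> h H I K)"
    unfolding s10[symmetric] by (rule U[OF d(6,7) sym])
  have ACI: "nonoverlapping (h A C I) (h A H K \<union> h H I K)"
    by (rule mono(3)) (use s7 s8 s9 s10 in auto)
  \<comment> \<open>\<open>HIK\<close> straddles the line \<open>AE\<close>, so each of its halves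
    is separated from \<open>AHI\<close> on its own: one by \<open>AE\<close>, the other by
    \<open>IH\<close>.\<close>
  have "nonoverlapping (h E H K \<union> (h A H K \<union> h E H I)) (h A H I)"
  proof (intro Un)
    show "nonoverlapping (h E H K) (h A H I)" by (rule sym, rule mono(4)) (use s8 s9 in auto)
    show "nonoverlapping (h A H K) (h A H I)" by (rule sym, rule mono(4)) (use s8 s9 in auto)
    show "nonoverlapping (h E H I) (h A H I)" by (rule sym[OF s8(2)])
  qed
  then have "nonoverlapping (h A H I) (h A H K \<union> h H I K)"
    by (rule sym[OF nonoverlapping_mono]) (use s10 in auto)
  then have "nonoverlapping (h A C I \<union> h A H I) (h A H K \<union> h H I K)" by (rule Un[OF ACI])
  then have "nonoverlapping (h C D I \<union> (h A D I \<union> h A H I)) (h A H K \<union> h H I K)"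
    by (rule nonoverlapping_mono) (use s6 in auto)
  then have "dissects T ((n4 + n5) + (n6 + n7)) (h C D I \<union> (h A D I \<union> h A H I) \<union> (h A H K \<union> h H I K))"
    by (rule U[OF d45 d67])
  moreover have "h C D I \<union> (h A D I \<union> h A H I) \<union> (h A H K \<union> h H I K) = h A C K"
    using s5 s6 s7 s8 s9 s10 by auto
  ultimately have "dissects T ((n4 + n5) + (n6 + n7)) (h A C K)" by simp
  then have "dissects T (((n4 + n5) + (n6 + n7)) + ((n1 + n2) + n3)) (h A C K \<union> h B C K)"
    by (intro U[OF _ right s1(2)])
  then show ?thesis using s1(1) by (simp add: h_def)
qed

section \<open>Placing the tile, and coordinates adapted to it\<close>

lemma inner_dist:
  fixes P Q R :: "real ^ 2"
  shows "(Q - P) \<bullet> (R - P) = ((dist P Q)\<^sup>2 + (dist P R)\<^sup>2 - (dist Q R)\<^sup>2) / 2"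
  unfolding dist_norm power2_norm_eq_inner by (simp add: inner_2 power2_eq_square algebra_simps)

text \<open>Equal side lengths give equal squared determinants by \<open>wedge_square\<close>, so
  \<open>PQR\<close> is nondegenerate. Negating \<open>u\<close> and \<open>v\<close> changes no
  length, which gives the half-turned copies.\<close>

lemma lattice_tile_triangle:
  assumes uv: "wedge u v \<noteq> 0"
    and d: "dist P Q = norm u" "dist P R = norm v" "dist Q R = norm (u - v)"
  shows "lattice_tile (convex hull {P, Q, R}) u v"
proof -
  have "(Q - P) \<bullet> (R - P) = u \<bullet> v"
    using inner_dist[of Q P R] inner_dist[of u 0 v] d by (simp add: dist_norm)
  then have "(wedge (Q - P) (R - P))\<^sup>2 = (wedge u v)\<^sup>2"
    using d unfolding wedge_square by (simp add: dist_norm norm_minus_commute)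
  then have w: "wedge (Q - P) (R - P) \<noteq> 0" using uv by auto
  then have "\<not> collinear {P, Q, R}" using collinear_wedge by blast
  then show ?thesis
    using uv congruent_triangles[OF w d] congruent_triangles[OF w, of "- u" "- v"] d triangle_regular
    by (simp add: lattice_tile_def norm_minus_commute)
qed

text \<open>Affine coordinates in which every vertex below becomes polynomial in \<open>s\<close>:
  with \<open>s = 2 sin (\<alpha> / 2)\<close>, the unit vector at angle \<open>\<alpha>\<close> to the first axis
  has coordinates \<open>(1 - s\<^sup>2 / 2, s)\<close>.\<close>

definition pt :: "real \<Rightarrow> real \<Rightarrow> real \<Rightarrow> real \<Rightarrow> real ^ 2" where
  "pt s c x y = vector [c * x, c * sqrt (1 - s\<^sup>2 / 4) * y]"

lemma pt_add: "pt s c x y + pt s c x' y' = pt s c (x + x') (y + y')"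
  and pt_diff: "pt s c x y - pt s c x' y' = pt s c (x - x') (y - y')"
  and pt_scale: "t *\<^sub>R pt s c x y = pt s c (t * x) (t * y)"
  by (simp_all add: pt_def vec_eq_2 algebra_simps)

lemma wedge_pt: "wedge (pt s c x y) (pt s c x' y') = c\<^sup>2 * sqrt (1 - s\<^sup>2 / 4) * (x * y' - y * x')"
  by (simp add: pt_def wedge_def power2_eq_square algebra_simps)

lemma inner_pt:
  assumes "s\<^sup>2 \<le> 4"
  shows "pt s c x y \<bullet> pt s c x' y' = c\<^sup>2 * (x * x' + (1 - s\<^sup>2 / 4) * (y * y'))"
proof -
  have "(sqrt (1 - s\<^sup>2 / 4))\<^sup>2 = 1 - s\<^sup>2 / 4" using assms by simp
  moreover have "pt s c x y \<bullet> pt s c x' y' = c\<^sup>2 * (x * x' + (sqrt (1 - s\<^sup>2 / 4))\<^sup>2 * (y * y'))"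
    by (simp add: pt_def inner_2 power2_eq_square algebra_simps)
  ultimately show ?thesis by simp
qed

lemma norm_pt:
  assumes "s\<^sup>2 \<le> 4" "0 \<le> c" "0 \<le> z" "x\<^sup>2 + (1 - s\<^sup>2 / 4) * y\<^sup>2 = z\<^sup>2"
  shows "norm (pt s c x y) = c * z"
proof -
  have "(norm (pt s c x y))\<^sup>2 = (c * z)\<^sup>2"
    unfolding power2_norm_eq_inner inner_pt[OF assms(1)] power_mult_distrib assms(4)[symmetric]
    by (simp add: power2_eq_square)
  then show ?thesis using assms(2,3) by (simp add: power2_eq_iff_nonneg)
qed

lemma pt_in_segment:
  assumes "0 \<le> t" "t \<le> 1" "x = (1 - t) * x1 + t * x2" "y = (1 - t) * y1 + t * y2"
  shows "pt s c x y \<in> closed_segment (pt s c x1 y1) (pt s c x2 y2)"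
  unfolding closed_segment_def using assms
  by (intro CollectI exI[of _ t]) (simp add: pt_add pt_scale)

text \<open>Reduces an angle to three polynomial identities in \<open>s\<close>: two lengths and one
  inner product.\<close>

lemma angle_at_pt:
  assumes "s\<^sup>2 \<le> 4" "0 < c" "0 < z" "0 < z'" "0 \<le> \<theta>" "\<theta> \<le> pi"
    and "P - Q = pt s c x y" "R - Q = pt s c x' y'"
    and "x\<^sup>2 + (1 - s\<^sup>2 / 4) * y\<^sup>2 = z\<^sup>2" "x'\<^sup>2 + (1 - s\<^sup>2 / 4) * y'\<^sup>2 = z'\<^sup>2"
    and "x * x' + (1 - s\<^sup>2 / 4) * (y * y') = cos \<theta> * (z * z')"
  shows "angle_at P Q R = \<theta>"
proof -
  have "norm (P - Q) = c * z" "norm (R - Q) = c * z'"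
    unfolding assms(7,8) using assms by (auto intro!: norm_pt)
  moreover have "(P - Q) \<bullet> (R - Q) = c\<^sup>2 * (cos \<theta> * (z * z'))"
    unfolding assms(7,8) inner_pt[OF assms(1)] assms(11) ..
  ultimately have "angle_at P Q R = arccos (c\<^sup>2 * (cos \<theta> * (z * z')) / ((c * z) * (c * z')))"
    by (simp add: angle_at_def)
  also have "c\<^sup>2 * (cos \<theta> * (z * z')) / ((c * z) * (c * z')) = cos \<theta>"
    using assms by (simp add: power2_eq_square)
  finally show ?thesis using assms by (simp add: arccos_cos)
qed

section \<open>The seven pieces in coordinates\<close>

text \<open>\<open>p\<close>, \<open>r\<close>, \<open>d\<close>, \<open>m\<close> are the sides of
  the pieces counted in tile edges; integrality enters only through them. \<open>A\<close> is the
  origin, \<open>B\<close> lies on the first axis, and \<open>C\<close> lies at angle 2\<alpha> at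
  distance \<open>l * c\<close>.\<close>

lemma triangle_tiled_by_tile:
  fixes s c :: real and l p r d m :: nat and P Q R :: "real ^ 2"
  assumes s: "0 < s" "s < 1" and c: "0 < c" and l: "0 < l"
    and p: "real p = l * s" and r: "real r = l * s\<^sup>2" and d: "real d = l * (1 - s\<^sup>2)"
    and m: "real m = l * (2 - s\<^sup>2 - s)"
    and tile: "dist Q R = c * s" "dist P R = c * (1 - s\<^sup>2)" "dist P Q = c"
  shows "tiled_by (((d\<^sup>2 + 2 * r * d) + (d\<^sup>2 + p\<^sup>2)) + ((m\<^sup>2 + 2 * p * m) + p\<^sup>2))
    (convex hull {pt s c 0 0, pt s c (l * ((1 - s\<^sup>2) * (3 - s\<^sup>2))) 0,
      pt s c (l * (1 - 2 * s\<^sup>2 + s ^ 4 / 2)) (l * (2 * s - s ^ 3))})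
    (convex hull {P, Q, R})"
proof -
  let ?T = "convex hull {P, Q, R}"
  define V where "V = pt s c"
  have "s * s < s * 1" using s by (intro mult_strict_left_mono)
  then have "s\<^sup>2 < s" by (simp add: power2_eq_square)
  then have s2: "0 < s\<^sup>2" "s\<^sup>2 < 1" "s\<^sup>2 \<le> 4" using s by simp_all
  have "s\<^sup>2 + s < 2" using s s2 by linarith
  have "0 < real p" "0 < real r" "0 < real d" "0 < real m"
    unfolding p r d m using l s s2 \<open>s\<^sup>2 + s < 2\<close> by simp_all
  then have pos: "0 < p" "0 < r" "0 < d" "0 < m" by simp_all
  have w0: "sqrt (1 - s\<^sup>2 / 4) > 0" using s2 by simp
  have Vadd: "V x y + V x' y' = V (x + x') (y + y')" "V x y - V x' y' = V (x - x') (y - y')"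
    "t *\<^sub>R V x y = V (t * x) (t * y)" for x y x' y' t
    by (simp_all add: V_def pt_add pt_diff pt_scale)
  have VN: "norm (V x y) = c * z" if "0 \<le> z" "x\<^sup>2 + (1 - s\<^sup>2 / 4) * y\<^sup>2 = z\<^sup>2" for x y z
    using norm_pt that s2 c by (simp add: V_def)
  have W: "wedge (V x y) (V x' y') \<noteq> 0" if "x * y' - y * x' \<noteq> 0" for x y x' y'
    using that w0 c by (simp add: V_def wedge_pt)
  \<comment> \<open>\<open>X\<close> is the tile vertex placed at the base point. The value
    \<open>s * (1 - s\<^sup>2)\<close> is the determinant common to all placements, up to sign and
    the factor in \<open>wedge_pt\<close>.\<close>
  have lat: "lattice_tile ?T (V x y) (V x' y')"
    if "{X, Y, Z} = {P, Q, R}" "dist X Y = c * z1" "dist X Z = c * z2" "dist Y Z = c * z3"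
      "z1 \<in> {s, 1 - s\<^sup>2, 1}" "z2 \<in> {s, 1 - s\<^sup>2, 1}" "z3 \<in> {s, 1 - s\<^sup>2, 1}"
      and "\<bar>x * y' - y * x'\<bar> = s * (1 - s\<^sup>2)"
      and "x\<^sup>2 + (1 - s\<^sup>2 / 4) * y\<^sup>2 = z1\<^sup>2" "x'\<^sup>2 + (1 - s\<^sup>2 / 4) * y'\<^sup>2 = z2\<^sup>2"
      "(x - x')\<^sup>2 + (1 - s\<^sup>2 / 4) * (y - y')\<^sup>2 = z3\<^sup>2"
    for X Y Z x y x' y' z1 z2 z3
  proof -
    have "0 \<le> z" if "z \<in> {s, 1 - s\<^sup>2, 1}" for z using that s s2 by auto
    then have "0 \<le> z1" "0 \<le> z2" "0 \<le> z3" using that(5-7) by simp_all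
    moreover have "x * y' - y * x' \<noteq> 0" using that(8) s s2 by auto
    ultimately show ?thesis unfolding that(1)[symmetric] using that(2-4,9-11)
      by (intro lattice_tile_triangle W) (simp_all only: Vadd VN not_False_eq_True)
  qed
  have k0: "\<bar>x\<bar> = s * (1 - s\<^sup>2)" if "x = s * (1 - s\<^sup>2) \<or> x = - (s * (1 - s\<^sup>2))" for x
    using that s s2 by (auto simp: abs_mult)
  note tile' = tile tile(1)[unfolded dist_commute[of Q R]] tile(2)[unfolded dist_commute[of P R]]
    tile(3)[unfolded dist_commute[of P Q]]
  \<comment> \<open>Edge vectors by piece: \<open>la\<close> for \<open>FGB\<close> and
    \<open>FCJ\<close>, \<open>lb\<close> for \<open>KGFJ\<close>, \<open>lc\<close> for
    \<open>DCI\<close> and \<open>ADIH\<close>, \<open>ld\<close> for \<open>AHK\<close>,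
    \<open>le\<close> for \<open>HIK\<close>. The base vertex carries \<alpha> in \<open>la\<close>,
    \<open>lc\<close>, \<open>ld\<close> and \<gamma> in \<open>lb\<close>,
    \<open>le\<close>.\<close>
  have la: "lattice_tile ?T (V (- (1 - s\<^sup>2)) 0) (V (- (1 - s\<^sup>2 / 2)) s)"
    by (rule lat[of P R Q "1 - s\<^sup>2" 1 s]; (rule k0)?)
      (simp_all add: tile' insert_commute, simp_all add: field_simps eval_nat_numeral)
  have lb: "lattice_tile ?T (V (1 - s\<^sup>2) 0) (V (- (s\<^sup>2 / 2)) s)"
    by (rule lat[of R P Q "1 - s\<^sup>2" s 1]; (rule k0)?)
      (simp_all add: tile' insert_commute, simp_all add: field_simps eval_nat_numeral)
  have lc: "lattice_tile ?T (V (1 - 2 * s\<^sup>2 + s ^ 4 / 2) (2 * s - s ^ 3))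
    (V ((1 - s\<^sup>2) * (1 - s\<^sup>2 / 2)) ((1 - s\<^sup>2) * s))"
    by (rule lat[of P Q R 1 "1 - s\<^sup>2" s]; (rule k0)?)
      (simp_all add: tile' insert_commute, simp_all add: field_simps eval_nat_numeral)
  have ld: "lattice_tile ?T (V 1 0)
    (V ((1 - s\<^sup>2) * (1 - s\<^sup>2 / 2)) ((1 - s\<^sup>2) * s))"
    by (rule lat[of P Q R 1 "1 - s\<^sup>2" s]; (rule k0)?)
      (simp_all add: tile' insert_commute, simp_all add: field_simps eval_nat_numeral)
  have le: "lattice_tile ?T (V (s * (1 - 2 * s\<^sup>2 + s ^ 4 / 2)) (s * (2 * s - s ^ 3)))
    (V ((1 - s\<^sup>2) * (3 * s / 2 - s ^ 3 / 2)) (- ((1 - s\<^sup>2)\<^sup>2)))"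
    by (rule lat[of R Q P s "1 - s\<^sup>2" 1]; (rule k0)?)
      (simp_all add: tile' insert_commute, simp_all add: field_simps eval_nat_numeral)
  define A B C where "A = V 0 0" and "B = V (l * ((1 - s\<^sup>2) * (3 - s\<^sup>2))) 0"
    and "C = V (l * (1 - 2 * s\<^sup>2 + s ^ 4 / 2)) (l * (2 * s - s ^ 3))"
  define K G where "K = V (l * (1 - s\<^sup>2)) 0" and "G = V (l * ((1 - s\<^sup>2) * (1 + s))) 0"
  define F where "F = V (l * (1 + s - 2 * s\<^sup>2 - s ^ 3 / 2 + s ^ 4 / 2)) (l * (2 * s - s\<^sup>2 - s ^ 3))"
  define J where "J = V (l * (1 - 2 * s\<^sup>2 + s ^ 3 / 2 + s ^ 4 / 2)) (l * (2 * s - s\<^sup>2 - s ^ 3))"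
  define D where "D = V (l * (s\<^sup>2 * (1 - 2 * s\<^sup>2 + s ^ 4 / 2))) (l * (s\<^sup>2 * (2 * s - s ^ 3)))"
  define E where "E = V (l * ((1 - s\<^sup>2) * (1 - s\<^sup>2 / 2))) (l * ((1 - s\<^sup>2) * s))"
  define H where "H = V (l * ((1 - s\<^sup>2)\<^sup>2 * (1 - s\<^sup>2 / 2))) (l * ((1 - s\<^sup>2)\<^sup>2 * s))"
  define I where "I = V (l * (s\<^sup>2 * (1 - 2 * s\<^sup>2 + s ^ 4 / 2) + (1 - s\<^sup>2)\<^sup>2 * (1 - s\<^sup>2 / 2)))
    (l * (s\<^sup>2 * (2 * s - s ^ 3) + (1 - s\<^sup>2)\<^sup>2 * s))"
  note pts = A_def B_def C_def K_def G_def F_def J_def D_def E_def H_def I_def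
  have Veq: "V x y = V x' y'" if "x = x'" "y = y'" for x y x' y' using that by simp
  \<comment> \<open>Segment parameters: \<open>t1\<close> is \<open>AK / AB\<close>. Since
    \<open>FG\<close> and \<open>FJ\<close> are parallel to \<open>KC\<close> and \<open>AB\<close>,
    the single ratio \<open>t2\<close> serves \<open>F\<close>, \<open>G\<close> and
    \<open>J\<close>. For \<open>t3\<close>, the bisector theorem gives
    \<open>CE / CK = 1 / (2 - s\<^sup>2)\<close>, and \<open>DI\<close> parallel to
    \<open>AE\<close> multiplies this by \<open>CD / CA = 1 - s\<^sup>2\<close>.\<close>
  have t1: "0 \<le> 1 / (3 - s\<^sup>2)" "1 / (3 - s\<^sup>2) \<le> 1" "3 - s\<^sup>2 \<noteq> 0" using s2 by auto
  have t2: "0 \<le> s / (2 - s\<^sup>2)" "s / (2 - s\<^sup>2) \<le> 1" "2 - s\<^sup>2 \<noteq> 0"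
    using s s2 \<open>s\<^sup>2 + s < 2\<close> by (auto simp: field_simps)
  have t3: "0 \<le> (1 - s\<^sup>2) / (2 - s\<^sup>2)" "(1 - s\<^sup>2) / (2 - s\<^sup>2) \<le> 1" using s2 by (auto simp: field_simps)
  have t4: "0 \<le> s\<^sup>2" "s\<^sup>2 \<le> 1" "0 \<le> 1 - s\<^sup>2" "1 - s\<^sup>2 \<le> 1" using s2 by auto
  have "K \<in> closed_segment A B" unfolding pts V_def
    by (rule pt_in_segment[OF t1(1,2)]) (use t1(3) in \<open>simp_all add: field_simps\<close>)
  moreover have "F \<in> closed_segment C B" unfolding pts V_def
    by (rule pt_in_segment[OF t2(1,2)]) (use t2(3) in \<open>simp_all add: divide_simps,
        simp_all add: algebra_simps eval_nat_numeral\<close>)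
  moreover have "G \<in> closed_segment K B" unfolding pts V_def
    by (rule pt_in_segment[OF t2(1,2)]) (use t2(3) in \<open>simp_all add: divide_simps,
        simp_all add: algebra_simps eval_nat_numeral\<close>)
  moreover have "J \<in> closed_segment C K" unfolding pts V_def
    by (rule pt_in_segment[OF t2(1,2)]) (use t2(3) in \<open>simp_all add: divide_simps,
        simp_all add: algebra_simps eval_nat_numeral\<close>)
  moreover have "I \<in> closed_segment C K" unfolding pts V_def
    by (rule pt_in_segment[OF t3(1,2)]) (use t2(3) in \<open>simp_all add: divide_simps,
        simp_all add: algebra_simps eval_nat_numeral\<close>)
  moreover have "D \<in> closed_segment A C" unfolding pts V_def
    by (rule pt_in_segment[OF t4(1,2)]) (simp_all add: field_simps)
  moreover have "E \<in> closed_segment I K" unfolding pts V_def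
    by (rule pt_in_segment[OF t4(1,2)]) (simp_all add: field_simps eval_nat_numeral)
  moreover have "H \<in> closed_segment A E" unfolding pts V_def
    by (rule pt_in_segment[OF t4(3,4)]) (simp_all add: field_simps eval_nat_numeral)
  moreover have "dissects ?T (m\<^sup>2) (convex hull {F, G, B})"
  proof -
    have "G = B + m *\<^sub>R V (- (1 - s\<^sup>2)) 0" "F = B + m *\<^sub>R V (- (1 - s\<^sup>2 / 2)) s"
      unfolding pts Vadd m by (rule Veq; simp add: field_simps eval_nat_numeral)+
    then show ?thesis using dissects_tri[OF la pos(4), of B] hull_eq_tri[of m B] pos(4)
      by (simp add: insert_commute)
  qed
  moreover have "dissects ?T (2 * p * m) (convex hull {K, G, F} \<union> convex hull {K, J, F})"
  proof -
    have "G = K + p *\<^sub>R V (1 - s\<^sup>2) 0" "J = K + m *\<^sub>R V (- (s\<^sup>2 / 2)) s"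
      "F = K + p *\<^sub>R V (1 - s\<^sup>2) 0 + m *\<^sub>R V (- (s\<^sup>2 / 2)) s"
      unfolding pts Vadd m p by (rule Veq; simp add: field_simps eval_nat_numeral)+
    then show ?thesis using dissects_par[OF lb pos(1,4), of K] par_eq_triangles[of p m K] pos
      by simp
  qed
  moreover have "dissects ?T (p\<^sup>2) (convex hull {F, C, J})"
  proof -
    have "J = F + p *\<^sub>R V (- (1 - s\<^sup>2)) 0" "C = F + p *\<^sub>R V (- (1 - s\<^sup>2 / 2)) s"
      unfolding pts Vadd p by (rule Veq; simp add: field_simps eval_nat_numeral)+
    then show ?thesis using dissects_tri[OF la pos(1), of F] hull_eq_tri[of p F] pos(1)
      by (simp add: insert_commute)
  qed
  moreover have "dissects ?T (d\<^sup>2) (convex hull {D, C, I})"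
  proof -
    have "C = D + d *\<^sub>R V (1 - 2 * s\<^sup>2 + s ^ 4 / 2) (2 * s - s ^ 3)"
      "I = D + d *\<^sub>R V ((1 - s\<^sup>2) * (1 - s\<^sup>2 / 2)) ((1 - s\<^sup>2) * s)"
      unfolding pts Vadd d by (rule Veq; simp add: field_simps eval_nat_numeral)+
    then show ?thesis using dissects_tri[OF lc pos(3), of D] hull_eq_tri[of d D] pos(3) by simp
  qed
  moreover have "dissects ?T (2 * r * d) (convex hull {A, D, I} \<union> convex hull {A, H, I})"
  proof -
    have "D = A + r *\<^sub>R V (1 - 2 * s\<^sup>2 + s ^ 4 / 2) (2 * s - s ^ 3)"
      "H = A + d *\<^sub>R V ((1 - s\<^sup>2) * (1 - s\<^sup>2 / 2)) ((1 - s\<^sup>2) * s)"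
      "I = A + r *\<^sub>R V (1 - 2 * s\<^sup>2 + s ^ 4 / 2) (2 * s - s ^ 3) +
        d *\<^sub>R V ((1 - s\<^sup>2) * (1 - s\<^sup>2 / 2)) ((1 - s\<^sup>2) * s)"
      unfolding pts Vadd d r by (rule Veq; simp add: field_simps eval_nat_numeral)+
    then show ?thesis using dissects_par[OF lc pos(2,3), of A] par_eq_triangles[of r d A] pos
      by simp
  qed
  moreover have "dissects ?T (d\<^sup>2) (convex hull {A, H, K})"
  proof -
    have "K = A + d *\<^sub>R V 1 0" "H = A + d *\<^sub>R V ((1 - s\<^sup>2) * (1 - s\<^sup>2 / 2)) ((1 - s\<^sup>2) * s)"
      unfolding pts Vadd d by (rule Veq; simp add: field_simps eval_nat_numeral)+
    then show ?thesis using dissects_tri[OF ld pos(3), of A] hull_eq_tri[of d A] pos(3)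
      by (simp add: insert_commute)
  qed
  moreover have "dissects ?T (p\<^sup>2) (convex hull {H, I, K})"
  proof -
    have "I = H + p *\<^sub>R V (s * (1 - 2 * s\<^sup>2 + s ^ 4 / 2)) (s * (2 * s - s ^ 3))"
      "K = H + p *\<^sub>R V ((1 - s\<^sup>2) * (3 * s / 2 - s ^ 3 / 2)) (- ((1 - s\<^sup>2)\<^sup>2))"
      unfolding pts Vadd p by (rule Veq; simp add: field_simps eval_nat_numeral)+
    then show ?thesis using dissects_tri[OF le pos(1), of H] hull_eq_tri[of p H] pos(1) by simp
  qed
  ultimately have "dissects ?T (((d\<^sup>2 + 2 * r * d) + (d\<^sup>2 + p\<^sup>2)) + ((m\<^sup>2 + 2 * p * m) + p\<^sup>2))
      (convex hull {A, B, C})"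
    by (rule dissects_seven_pieces[OF lattice_tileD(1,2)[OF la]])
  moreover have "compact ?T" by (intro finite_imp_compact_convex_hull) simp
  ultimately show ?thesis
    using dissects_imp_tiled_by lattice_tileD(2)[OF la] by (simp add: A_def B_def C_def V_def)
qed

section \<open>Angles of the tile\<close>

text \<open>With sin \<theta> = s/2, the double and triple angle formulas give \<alpha> = 2\<theta>
  and \<beta> = \<pi>/2 - 3\<theta>, from which the angle relation is immediate.\<close>

lemma tile_angles:
  fixes s :: real
  assumes "0 < s" "s < 1"
  defines "\<alpha> \<equiv> arccos (1 - s\<^sup>2 / 2)" and "\<beta> \<equiv> arccos ((3 * s - s ^ 3) / 2)"
  shows "3 * \<alpha> + 2 * \<beta> = pi" "0 \<le> \<alpha>" "2 * \<alpha> \<le> pi" "0 \<le> \<beta>" "2 * \<beta> \<le> pi"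
    "cos \<alpha> = 1 - s\<^sup>2 / 2" "cos \<beta> = (3 * s - s ^ 3) / 2"
proof -
  define \<theta> where "\<theta> = arcsin (s / 2)"
  have sin: "sin \<theta> = s / 2" using assms by (simp add: \<theta>_def)
  \<comment> \<open>\<open>s < 1\<close> gives \<theta> < \<pi>/6, which keeps \<beta> positive and
    both angles in the range where \<open>arccos\<close> inverts \<open>cos\<close>.\<close>
  have "arcsin (s / 2) < arcsin (1 / 2)" "arcsin 0 < arcsin (s / 2)"
    using assms by (intro arcsin_less_arcsin; simp)+
  moreover have "arcsin (1 / 2) = pi / 6"
    using arcsin_sin[of "pi / 6"] by (simp add: sin_30)
  ultimately have \<theta>: "0 < \<theta>" "\<theta> < pi / 6" by (simp_all add: \<theta>_def)
  have c2: "cos (2 * \<theta>) = 1 - s\<^sup>2 / 2"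
    unfolding cos_double_sin sin by (simp add: power2_eq_square)
  have "sin (3 * \<theta>) = sin (2 * \<theta> + \<theta>)" by simp
  also have "\<dots> = 2 * sin \<theta> * (cos \<theta>)\<^sup>2 + cos (2 * \<theta>) * sin \<theta>"
    unfolding sin_add sin_double by (simp add: power2_eq_square)
  also have "\<dots> = (3 * s - s ^ 3) / 2"
    unfolding cos_squared_eq c2 sin by (simp add: field_simps eval_nat_numeral)
  finally have c3: "cos (pi / 2 - 3 * \<theta>) = (3 * s - s ^ 3) / 2" by (simp add: cos_diff)
  have \<alpha>: "\<alpha> = 2 * \<theta>" unfolding \<alpha>_def c2[symmetric] using \<theta> by (intro arccos_cos) auto
  have \<beta>: "\<beta> = pi / 2 - 3 * \<theta>" unfolding \<beta>_def c3[symmetric] using \<theta> by (intro arccos_cos) auto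
  show "3 * \<alpha> + 2 * \<beta> = pi" "0 \<le> \<alpha>" "2 * \<alpha> \<le> pi" "0 \<le> \<beta>" "2 * \<beta> \<le> pi"
    "cos \<alpha> = 1 - s\<^sup>2 / 2" "cos \<beta> = (3 * s - s ^ 3) / 2"
    using \<theta> c2 c3 \<alpha> \<beta> by auto
qed

lemma angle_at_law_of_cosines:
  "angle_at P Q R =
    arccos (((dist P Q)\<^sup>2 + (dist Q R)\<^sup>2 - (dist P R)\<^sup>2) / (2 * dist P Q * dist Q R))"
  unfolding angle_at_def inner_dist by (simp add: dist_norm norm_minus_commute algebra_simps)

section \<open>Integrality, angles and the number of tiles\<close>

theorem theorem10:
  fixes a c :: nat and b s M \<alpha> \<beta> :: real and P Q R :: "real ^ 2"
  assumes "0 < a" and "a < c" and "c dvd a\<^sup>2"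
    and "b = real c - (real a)\<^sup>2 / real c"
    and "dist Q R = real a" and "dist P R = b" and "dist P Q = real c"
    and "\<alpha> = angle_at Q P R" and "\<beta> = angle_at P Q R"
    and "s = real a / real c"
    and "M = real (lcm a c) * (2 - s\<^sup>2 - s)"
  shows "b \<in> \<int> \<and> 3 * \<alpha> + 2 * \<beta> = pi \<and> M \<in> \<int> \<and>
    (\<exists>(N :: nat) (A :: real ^ 2) (B :: real ^ 2) (C :: real ^ 2).
       real N = M\<^sup>2 * ((2 - s\<^sup>2) * (3 - s\<^sup>2)) / ((1 - s)\<^sup>2 * (2 + s)\<^sup>2) \<and>
       \<not> collinear {A, B, C} \<and>
       angle_at B A C = 2 * \<alpha> \<and> angle_at A B C = \<alpha> \<and> angle_at A C B = 2 * \<beta> \<and>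
       tiled_by N (convex hull {A, B, C}) (convex hull {P, Q, R}))"
proof -
  have c: "0 < real c" using assms(1,2) by simp
  have s: "0 < s" "s < 1" using assms(1,2,10) by auto
  have a: "real a = c * s" using c assms(10) by simp
  have b: "b = c * (1 - s\<^sup>2)"
    using c unfolding assms(4,10) by (simp add: field_simps power2_eq_square)
  have "s * s < s * 1" using s by (intro mult_strict_left_mono)
  then have "s\<^sup>2 < s" by (simp add: power2_eq_square)
  then have s2: "0 < s\<^sup>2" "s\<^sup>2 < 1" "s\<^sup>2 \<le> 4" using s by simp_all

  \<comment> \<open>\<open>e\<close> is the integer \<open>a\<^sup>2 / c\<close>, which equals
    \<open>c * s\<^sup>2\<close>; hence \<open>b = c - e\<close>.\<close>
  obtain e where e: "a\<^sup>2 = c * e" using assms(3) by (rule dvdE)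
  have "real (a\<^sup>2) = real (c * e)" by (simp only: e)
  then have "(c * s)\<^sup>2 = c * real e" by (simp add: a)
  then have "c * (c * s\<^sup>2) = c * real e" by (simp add: power2_eq_square mult_ac)
  then have cs2: "c * s\<^sup>2 = e" using c by simp
  have "b = real_of_int (int c - int e)" by (simp add: b right_diff_distrib cs2)
  then have "b \<in> \<int>" by (metis Ints_of_int)

  have "c dvd lcm a c" by simp
  then obtain q where q: "lcm a c = c * q" by (rule dvdE)
  define l where "l = lcm a c"
  have l: "0 < l" using assms(1,2) by (simp add: l_def lcm_pos_nat)
  have lq: "real l = c * q" by (simp add: l_def q)
  \<comment> \<open>Since \<open>l = c * q\<close>, the lengths \<open>l * s\<close> and
    \<open>l * s\<^sup>2\<close> are the naturals \<open>a * q\<close> and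
    \<open>e * q\<close>.\<close>
  define p r d m where "p = a * q" and "r = e * q" and "d = l - r" and "m = 2 * l - r - p"
  have p: "real p = l * s" by (simp add: p_def a lq)
  have r: "real r = l * s\<^sup>2" by (simp add: r_def lq flip: cs2)
  \<comment> \<open>These bounds ensure that the natural subtractions in \<open>d\<close> and
    \<open>m\<close> do not truncate.\<close>
  have "real r < real l" "real p < real l" unfolding p r using s s2 l by simp_all
  then have "r < l" "p < l" by simp_all
  then have "real d = real l - real r" "real m = 2 * real l - real r - real p"
    unfolding d_def m_def by (simp_all add: of_nat_diff)
  then have d: "real d = l * (1 - s\<^sup>2)" and m: "real m = l * (2 - s\<^sup>2 - s)"
    by (simp_all add: p r algebra_simps)
  have "M = real m" unfolding assms(11) m l_def ..
  then have "M \<in> \<int>" by simp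

  have "\<alpha> = arccos (1 - s\<^sup>2 / 2)"
  proof -
    have "((dist Q P)\<^sup>2 + (dist P R)\<^sup>2 - (dist Q R)\<^sup>2) / (2 * dist Q P * dist P R) = 1 - s\<^sup>2 / 2"
      unfolding dist_commute[of Q P] assms(5-7) a b using c s2
      by (simp add: divide_simps) (simp add: algebra_simps eval_nat_numeral)
    then show ?thesis unfolding assms(8) angle_at_law_of_cosines by (simp only:)
  qed
  moreover have "\<beta> = arccos ((3 * s - s ^ 3) / 2)"
  proof -
    have "((dist P Q)\<^sup>2 + (dist Q R)\<^sup>2 - (dist P R)\<^sup>2) / (2 * dist P Q * dist Q R) = (3 * s - s ^ 3) / 2"
      unfolding assms(5-7) a b using c s
      by (simp add: divide_simps) (simp add: algebra_simps eval_nat_numeral)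
    then show ?thesis unfolding assms(9) angle_at_law_of_cosines by (simp only:)
  qed
  ultimately have ang: "3 * \<alpha> + 2 * \<beta> = pi" "0 \<le> \<alpha>" "2 * \<alpha> \<le> pi" "0 \<le> \<beta>" "2 * \<beta> \<le> pi"
    "cos \<alpha> = 1 - s\<^sup>2 / 2" "cos \<beta> = (3 * s - s ^ 3) / 2"
    using tile_angles[OF s] by simp_all

  define A B C where "A = pt s c 0 0" and "B = pt s c (l * ((1 - s\<^sup>2) * (3 - s\<^sup>2))) 0"
    and "C = pt s c (l * (1 - 2 * s\<^sup>2 + s ^ 4 / 2)) (l * (2 * s - s ^ 3))"
  define N where "N = ((d\<^sup>2 + 2 * r * d) + (d\<^sup>2 + p\<^sup>2)) + ((m\<^sup>2 + 2 * p * m) + p\<^sup>2)"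
  have "wedge (B - A) (C - A) \<noteq> 0"
  proof -
    have "2 * s - s ^ 3 = s * (2 - s\<^sup>2)" by (simp add: algebra_simps eval_nat_numeral)
    then show ?thesis unfolding A_def B_def C_def pt_diff wedge_pt using c s s2 l by simp
  qed
  then have ncol: "\<not> collinear {A, B, C}" using collinear_wedge by blast
  have til: "tiled_by N (convex hull {A, B, C}) (convex hull {P, Q, R})"
    unfolding N_def A_def B_def C_def
    by (rule triangle_tiled_by_tile[OF s c l p r d m]) (use assms(5-7) a b in auto)
  \<comment> \<open>The sides \<open>AB\<close>, \<open>AC\<close>, \<open>BC\<close> divided by
    \<open>c\<close>.\<close>
  have z: "0 < l * ((1 - s\<^sup>2) * (3 - s\<^sup>2))" "0 < real l" "0 < l * (2 - s\<^sup>2)"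
    using l s2 by simp_all
  have side: "B - A = pt s c (l * ((1 - s\<^sup>2) * (3 - s\<^sup>2))) 0"
    "C - A = pt s c (l * (1 - 2 * s\<^sup>2 + s ^ 4 / 2)) (l * (2 * s - s ^ 3))"
    "A - B = pt s c (- (l * ((1 - s\<^sup>2) * (3 - s\<^sup>2)))) 0"
    "C - B = pt s c (l * (1 - 2 * s\<^sup>2 + s ^ 4 / 2) - l * ((1 - s\<^sup>2) * (3 - s\<^sup>2))) (l * (2 * s - s ^ 3))"
    "A - C = pt s c (- (l * (1 - 2 * s\<^sup>2 + s ^ 4 / 2))) (- (l * (2 * s - s ^ 3)))"
    "B - C = pt s c (l * ((1 - s\<^sup>2) * (3 - s\<^sup>2)) - l * (1 - 2 * s\<^sup>2 + s ^ 4 / 2)) (- (l * (2 * s - s ^ 3)))"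
    by (simp_all add: A_def B_def C_def pt_diff)
  have alpha_le: "\<alpha> \<le> pi" using ang(2,3) by linarith
  have cos2: "cos (2 * \<alpha>) = 1 - 2 * s\<^sup>2 + s ^ 4 / 2" "cos (2 * \<beta>) = (3 * s - s ^ 3)\<^sup>2 / 2 - 1"
    unfolding cos_double_cos ang(6,7) by (simp_all add: field_simps eval_nat_numeral)
  have "real N = M\<^sup>2 * ((2 - s\<^sup>2) * (3 - s\<^sup>2)) / ((1 - s)\<^sup>2 * (2 + s)\<^sup>2)"
  proof -
    \<comment> \<open>This factorization cancels the denominator, so the claimed count is
      \<open>l\<^sup>2 * (2 - s\<^sup>2) * (3 - s\<^sup>2)\<close>, to which the seven piece counts
      add up.\<close>
    have "M = l * ((1 - s) * (2 + s))"
      unfolding assms(11) l_def by (simp add: algebra_simps power2_eq_square)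
    then have "M\<^sup>2 = (real l)\<^sup>2 * ((1 - s)\<^sup>2 * (2 + s)\<^sup>2)" by (simp add: power_mult_distrib)
    moreover have "real N = (real l)\<^sup>2 * ((2 - s\<^sup>2) * (3 - s\<^sup>2))"
      unfolding N_def of_nat_add of_nat_mult of_nat_power p r d m
      by (simp add: algebra_simps eval_nat_numeral)
    ultimately show ?thesis using s by simp
  qed
  moreover have "angle_at B A C = 2 * \<alpha>"
    by (rule angle_at_pt[OF s2(3) c z(1,2) _ _ side(1,2)])
      (simp_all add: ang(2-5) cos2, simp_all add: field_simps eval_nat_numeral)
  moreover have "angle_at A B C = \<alpha>"
    by (rule angle_at_pt[OF s2(3) c z(1,3) _ _ side(3,4)])
      (simp_all add: ang(2-6) alpha_le, simp_all add: field_simps eval_nat_numeral)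
  moreover have "angle_at A C B = 2 * \<beta>"
    by (rule angle_at_pt[OF s2(3) c z(2,3) _ _ side(5,6)])
      (simp_all add: ang(2-5) cos2, simp_all add: field_simps eval_nat_numeral)
  ultimately show ?thesis using \<open>b \<in> \<int>\<close> \<open>M \<in> \<int>\<close> ang(1) ncol til by blast
qed

end
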